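(* Let $\mathsf p:\mathbb E\to\mathbb B$ be a latent hyperfibration. Then there is a restriction category $\mathbb E^*$ whose objects are those of $\mathbb E$ and whose maps $X\to Y$ are equivalence classes $[(v,h)]$ of spans $$X\xleftarrow{\;v\;}S\xrightarrow{\;h\;}Y$$ in $\mathbb E$ where $v$ is subvertical, $h$ is $\mathsf p$-prone and $\overline v=\overline h$, the equivalence being up to subvertical partial isomorphism; composition is by latent pullback, the identity on $X$ is the class of $(1_X,1_X)$, and the restriction is $\overline{[(v,h)]}=[(\widehat v,\widehat v)]$. Moreover, there is a restriction functor $\mathsf p^*:\mathbb E^*\to\mathbb B$ which is defined on objects by $\mathsf p^*(A)=\mathsf p(A)$ and on arrows by $\mathsf p^*([(v,h)])=\mathsf p(h)$.
   Context: Composition is written in diagrammatic order. A restriction category is a category with an operation sending each $f:A\to B$ to $\overline f:A\to A$ such that (R.1) $\overline f f=f$; (R.2) $\overline f\,\overline g=\overline g\,\overline f$ for $f,g$ with the same domain; (R.3) $\overline{\overline f g}=\overline f\,\overline g$ for $f,g$ with the same domain; (R.4) $f\overline g=\overline{fg}\,f$ for composable $f,g$. A restriction idempotent is an endomap $e=\overline e$; $\mathcal O(X)$ is the set of restriction idempotents on $X$. Parallel maps are ordered by $f\le g$ iff $\overline f g=f$. A partial isomorphism is a map $s$ with a (unique) partial inverse $s^{(-1)}$: $ss^{(-1)}=\overline s$, $s^{(-1)}s=\overline{s^{(-1)}}$. A restriction functor is a functor $F$ between restriction categories with $F(\overline f)=\overline{F(f)}$; a restriction semifunctor preserves domains, codomains,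 composition and restriction, but not necessarily identities. A commuting triangle $kf=g$ (with left factor $k$) is precise if $\overline g=\overline k$. For a restriction semifunctor $\mathsf p:\mathbb E\to\mathbb B$, an arrow $f':X'\to X$ of $\mathbb E$ is $\mathsf p$-prone if whenever $g:Y\to X$ in $\mathbb E$ and $h:\mathsf p(Y)\to\mathsf p(X')$ in $\mathbb B$ are such that $h\,\mathsf p(f')=\mathsf p(g)$ is precise, there is a unique $\widetilde h:Y\to X'$ with $\mathsf p(\widetilde h)=h$ and $\widetilde h f'=g$ precise. A restriction semifunctor $\mathsf p$ is a latent fibration if for each $X\in\mathbb E$ and $f:A\to\mathsf p(X)$ in $\mathbb B$ with $f=f\,\mathsf p(1_X)$ there is a $\mathsf p$-prone $f':X'\to X$ with $\mathsf p(f')=f$. $\mathsf p$ is hyperconnected if for every $X\in\mathbb E$ the map $\mathcal O(X)\to\{d\in\mathcal O(\mathsf p(X)): d\,\mathsf p(1_X)=d\}$, $e\mapsto\mathsf p(e)$, is an isomorphism. A latent hyperfibration is a hyperconnected latent fibration. A map $v:X\to Y$ of $\mathbb E$ is subvertical if $\mathsf p(v)$ is a restriction idempotent (so $\mathsf p(X)=\mathsf p(Y)$). For subvertical $v:S\to X$, $\widehat v$ denotes the unique restriction idempotent on $X$ with $\mathsf p(\widehat v)=\mathsf p(v)$. Two spans $(v:S\to X,\,h:S\to Y)$ and $(v':S'\to X,\,h':S'\to Y)$ are equivalent if there is a subvertical partial isomorphism $\alpha:S\to S'$ with $\alpha v'=v$, $\alpha h'=h$, $\alpha^{(-1)}v=v'$,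 $\alpha^{(-1)}h=h'$, $\overline\alpha=\overline h$ and $\overline{\alpha^{(-1)}}=\overline{h'}$. A commuting square $f'b=af$ with $f':A'\to B'$, $b:B'\to B$, $a:A'\to A$, $f:A\to B$ is a latent pullback if $f'\overline b=f'$, $a\overline f=a$, and for all $x_0:X\to B'$, $x_1:X\to A$ and every restriction idempotent $e$ on $X$ with $ex_1f=ex_0b$, $e\le\overline{x_1f}$, $e\le\overline{x_0b}$, there is a unique $k:X\to A'$ with $\overline k=e$, $kf'\le x_0$, $ka\le x_1$ and $k\overline{f'}=k\overline a=k$. Composition in $\mathbb E^*$: for representatives $X\xleftarrow{v_1}S\xrightarrow{h_1}Y$ and $Y\xleftarrow{v_2}T\xrightarrow{h_2}Z$, take a latent pullback of $h_1$ and $v_2$ with legs $v_2^\ast:P\to S$ subvertical and $h_1^\ast:P\to T$ $\mathsf p$-prone (these exist); the composite is $[(v_2^\ast v_1,\,h_1^\ast h_2)]$.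
   Formalization: Since p may be a semifunctor and p*[(1_X,1_X)] = p(1_X), p* need not preserve identities; it is shown to be a restriction semifunctor for every latent hyperfibration p, and a restriction functor whenever p itself preserves identities. *)

theory Defs
  imports Main
begin

section \<open>Categories and restriction categories\<close>

text \<open>Composition is in diagrammatic order throughout: for \<open>f : X \<rightarrow> Y\<close> and \<open>g : Y \<rightarrow> Z\<close>, the
  composite \<open>X \<rightarrow> Z\<close> is \<open>f \<cdot> g\<close>.  All operations are constrained only on \<open>Obj\<close> and \<open>Arr\<close>.\<close>

record ('o, 'm) rcat =
  Obj :: "'o set"
  Arr :: "'m set"
  Dom :: "'m \<Rightarrow> 'o"
  Cod :: "'m \<Rightarrow> 'o"
  Id :: "'o \<Rightarrow> 'm"
  Comp :: "'m \<Rightarrow> 'm \<Rightarrow> 'm" (infixl "\<cdot>\<index>" 70)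
  Rst :: "'m \<Rightarrow> 'm"

definition hom :: "('o, 'm) rcat \<Rightarrow> 'o \<Rightarrow> 'o \<Rightarrow> 'm set" where
  "hom C X Y = {f \<in> Arr C. Dom C f = X \<and> Cod C f = Y}"

locale category =
  fixes C :: "('o, 'm) rcat" (structure)
  assumes Dom_Obj: "f \<in> Arr C \<Longrightarrow> Dom C f \<in> Obj C"
    and Cod_Obj: "f \<in> Arr C \<Longrightarrow> Cod C f \<in> Obj C"
    and Id_hom: "X \<in> Obj C \<Longrightarrow> Id C X \<in> hom C X X"
    and Comp_hom: "f \<in> hom C X Y \<Longrightarrow> g \<in> hom C Y Z \<Longrightarrow> f \<cdot> g \<in> hom C X Z"
    and Id_left: "f \<in> hom C X Y \<Longrightarrow> Id C X \<cdot> f = f"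
    and Id_right: "f \<in> hom C X Y \<Longrightarrow> f \<cdot> Id C Y = f"
    and Comp_assoc: "f \<in> hom C W X \<Longrightarrow> g \<in> hom C X Y \<Longrightarrow> h \<in> hom C Y Z \<Longrightarrow>
      (f \<cdot> g) \<cdot> h = f \<cdot> (g \<cdot> h)"

locale restriction_category = category C for C :: "('o, 'm) rcat" (structure) +
  assumes Rst_hom: "f \<in> hom C X Y \<Longrightarrow> Rst C f \<in> hom C X X"
    and R1: "f \<in> hom C X Y \<Longrightarrow> Rst C f \<cdot> f = f"
    and R2: "f \<in> hom C X Y \<Longrightarrow> g \<in> hom C X Z \<Longrightarrow> Rst C f \<cdot> Rst C g = Rst C g \<cdot> Rst C f"
    and R3: "f \<in> hom C X Y \<Longrightarrow> g \<in> hom C X Z \<Longrightarrow> Rst C (Rst C f \<cdot> g) = Rst C f \<cdot> Rst C g"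
    and R4: "f \<in> hom C X Y \<Longrightarrow> g \<in> hom C Y Z \<Longrightarrow> f \<cdot> Rst C g = Rst C (f \<cdot> g) \<cdot> f"

definition restriction_idempotents :: "('o, 'm) rcat \<Rightarrow> 'o \<Rightarrow> 'm set" where
  "restriction_idempotents C X = {e \<in> hom C X X. e = Rst C e}"

definition rle :: "('o, 'm) rcat \<Rightarrow> 'm \<Rightarrow> 'm \<Rightarrow> bool" where
  "rle C f g \<longleftrightarrow> f \<in> Arr C \<and> g \<in> Arr C \<and> Dom C f = Dom C g \<and> Cod C f = Cod C g \<and>
     Rst C f \<cdot>\<^bsub>C\<^esub> g = f"

definition partial_inverse :: "('o, 'm) rcat \<Rightarrow> 'm \<Rightarrow> 'm \<Rightarrow> bool" where
  "partial_inverse C s t \<longleftrightarrow> s \<in> Arr C \<and> t \<in> hom C (Cod C s) (Dom C s) \<and>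
     s \<cdot>\<^bsub>C\<^esub> t = Rst C s \<and> t \<cdot>\<^bsub>C\<^esub> s = Rst C t"

definition precise :: "('o, 'm) rcat \<Rightarrow> 'm \<Rightarrow> 'm \<Rightarrow> 'm \<Rightarrow> bool" where
  "precise C k f g \<longleftrightarrow> k \<in> Arr C \<and> f \<in> Arr C \<and> Cod C k = Dom C f \<and>
     k \<cdot>\<^bsub>C\<^esub> f = g \<and> Rst C g = Rst C k"

text \<open>The arguments name the edges of the square

       \<open>A' --f'--> B'\<close>

       \<open>|a        |b\<close>

       \<open>A  --f-->  B\<close>

  so that the cospan is \<open>(f, b)\<close> and the legs are \<open>a\<close> and \<open>f'\<close>.\<close>

definition latent_pullback :: "('o, 'm) rcat \<Rightarrow> 'm \<Rightarrow> 'm \<Rightarrow> 'm \<Rightarrow> 'm \<Rightarrow> bool" where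
  "latent_pullback C f' b a f \<longleftrightarrow>
     f' \<in> Arr C \<and> b \<in> Arr C \<and> a \<in> Arr C \<and> f \<in> Arr C \<and>
     Dom C f' = Dom C a \<and> Cod C f' = Dom C b \<and> Cod C a = Dom C f \<and> Cod C b = Cod C f \<and>
     f' \<cdot>\<^bsub>C\<^esub> b = a \<cdot>\<^bsub>C\<^esub> f \<and> f' \<cdot>\<^bsub>C\<^esub> Rst C b = f' \<and> a \<cdot>\<^bsub>C\<^esub> Rst C f = a \<and>
     (\<forall>X \<in> Obj C. \<forall>x0 \<in> hom C X (Dom C b). \<forall>x1 \<in> hom C X (Dom C f).
        \<forall>e \<in> restriction_idempotents C X.
          e \<cdot>\<^bsub>C\<^esub> x1 \<cdot>\<^bsub>C\<^esub> f = e \<cdot>\<^bsub>C\<^esub> x0 \<cdot>\<^bsub>C\<^esub> b \<and>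
          rle C e (Rst C (x1 \<cdot>\<^bsub>C\<^esub> f)) \<and> rle C e (Rst C (x0 \<cdot>\<^bsub>C\<^esub> b)) \<longrightarrow>
          (\<exists>!k. k \<in> hom C X (Dom C f') \<and> Rst C k = e \<and>
             rle C (k \<cdot>\<^bsub>C\<^esub> f') x0 \<and> rle C (k \<cdot>\<^bsub>C\<^esub> a) x1 \<and>
             k \<cdot>\<^bsub>C\<^esub> Rst C f' = k \<and> k \<cdot>\<^bsub>C\<^esub> Rst C a = k))"


section \<open>Restriction semifunctors and latent hyperfibrations\<close>

text \<open>A (semi)functor \<open>p : E \<rightarrow> B\<close> is given by its object part \<open>po\<close> and its arrow part \<open>pa\<close>.\<close>

locale restriction_semifunctor =
  E: restriction_category E + B: restriction_category B
  for E :: "('o, 'm) rcat" and B :: "('b, 'n) rcat" +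
  fixes po :: "'o \<Rightarrow> 'b" and pa :: "'m \<Rightarrow> 'n"
  assumes po_Obj: "X \<in> Obj E \<Longrightarrow> po X \<in> Obj B"
    and pa_hom: "f \<in> hom E X Y \<Longrightarrow> pa f \<in> hom B (po X) (po Y)"
    and pa_Comp: "f \<in> hom E X Y \<Longrightarrow> g \<in> hom E Y Z \<Longrightarrow> pa (f \<cdot>\<^bsub>E\<^esub> g) = pa f \<cdot>\<^bsub>B\<^esub> pa g"
    and pa_Rst: "f \<in> hom E X Y \<Longrightarrow> pa (Rst E f) = Rst B (pa f)"

locale restriction_functor = restriction_semifunctor +
  assumes pa_Id: "X \<in> Obj E \<Longrightarrow> pa (Id E X) = Id B (po X)"

definition prone ::
  "('o, 'm) rcat \<Rightarrow> ('b, 'n) rcat \<Rightarrow> ('o \<Rightarrow> 'b) \<Rightarrow> ('m \<Rightarrow> 'n) \<Rightarrow> 'm \<Rightarrow> bool" where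
  "prone E B po pa f' \<longleftrightarrow> f' \<in> Arr E \<and>
     (\<forall>Y \<in> Obj E. \<forall>g \<in> hom E Y (Cod E f'). \<forall>h \<in> hom B (po Y) (po (Dom E f')).
        precise B h (pa f') (pa g) \<longrightarrow>
        (\<exists>!k. k \<in> hom E Y (Dom E f') \<and> pa k = h \<and> precise E k f' g))"

locale latent_fibration = restriction_semifunctor +
  assumes prone_lift: "X \<in> Obj E \<Longrightarrow> A \<in> Obj B \<Longrightarrow> f \<in> hom B A (po X) \<Longrightarrow>
    f = f \<cdot>\<^bsub>B\<^esub> pa (Id E X) \<Longrightarrow> \<exists>f'. prone E B po pa f' \<and> Cod E f' = X \<and> pa f' = f"

text \<open>A semifunctor preserves composites, that is, meets of restriction idempotents, so being an
  isomorphism amounts to being a bijection here.\<close>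

locale latent_hyperfibration = latent_fibration +
  assumes hyperconnected: "X \<in> Obj E \<Longrightarrow>
    bij_betw pa (restriction_idempotents E X)
      {d \<in> restriction_idempotents B (po X). d \<cdot>\<^bsub>B\<^esub> pa (Id E X) = d}"

definition subvertical ::
  "('o, 'm) rcat \<Rightarrow> ('b, 'n) rcat \<Rightarrow> ('o \<Rightarrow> 'b) \<Rightarrow> ('m \<Rightarrow> 'n) \<Rightarrow> 'm \<Rightarrow> bool" where
  "subvertical E B po pa v \<longleftrightarrow>
     v \<in> Arr E \<and> pa v \<in> restriction_idempotents B (po (Dom E v))"

definition hat :: "('o, 'm) rcat \<Rightarrow> ('m \<Rightarrow> 'n) \<Rightarrow> 'm \<Rightarrow> 'm" where
  "hat E pa v = (THE e. e \<in> restriction_idempotents E (Cod E v) \<and> pa e = pa v)"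


section \<open>Spans\<close>

text \<open>A span \<open>X \<leftarrow> S \<rightarrow> Y\<close> is the pair of its legs; the apex is their common domain.\<close>

definition spans :: "('o, 'm) rcat \<Rightarrow> ('b, 'n) rcat \<Rightarrow> ('o \<Rightarrow> 'b) \<Rightarrow> ('m \<Rightarrow> 'n) \<Rightarrow>
    'o \<Rightarrow> 'o \<Rightarrow> ('m \<times> 'm) set" where
  "spans E B po pa X Y = {(v, h).
     subvertical E B po pa v \<and> prone E B po pa h \<and>
     Dom E v = Dom E h \<and> Cod E v = X \<and> Cod E h = Y \<and> Rst E v = Rst E h}"

definition span_rel :: "('o, 'm) rcat \<Rightarrow> ('b, 'n) rcat \<Rightarrow> ('o \<Rightarrow> 'b) \<Rightarrow> ('m \<Rightarrow> 'n) \<Rightarrow>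
    'o \<Rightarrow> 'o \<Rightarrow> (('m \<times> 'm) \<times> ('m \<times> 'm)) set" where
  "span_rel E B po pa X Y = {((v, h), (v', h')).
     (v, h) \<in> spans E B po pa X Y \<and> (v', h') \<in> spans E B po pa X Y \<and>
     (\<exists>\<alpha> \<beta>. \<alpha> \<in> hom E (Dom E v) (Dom E v') \<and> subvertical E B po pa \<alpha> \<and>
        partial_inverse E \<alpha> \<beta> \<and>
        \<alpha> \<cdot>\<^bsub>E\<^esub> v' = v \<and> \<alpha> \<cdot>\<^bsub>E\<^esub> h' = h \<and> \<beta> \<cdot>\<^bsub>E\<^esub> v = v' \<and> \<beta> \<cdot>\<^bsub>E\<^esub> h = h' \<and>
        Rst E \<alpha> = Rst E h \<and> Rst E \<beta> = Rst E h')}"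

definition span_class :: "('o, 'm) rcat \<Rightarrow> ('b, 'n) rcat \<Rightarrow> ('o \<Rightarrow> 'b) \<Rightarrow> ('m \<Rightarrow> 'n) \<Rightarrow>
    'm \<Rightarrow> 'm \<Rightarrow> ('m \<times> 'm) set" where
  "span_class E B po pa v h = span_rel E B po pa (Cod E v) (Cod E h) `` {(v, h)}"

text \<open>The legs \<open>w : P \<rightarrow> S\<close> and \<open>k : P \<rightarrow> T\<close> along which \<open>h1 : S \<rightarrow> Y\<close> and \<open>v2 : T \<rightarrow> Y\<close> are
  composed.\<close>

definition composition_legs :: "('o, 'm) rcat \<Rightarrow> ('b, 'n) rcat \<Rightarrow> ('o \<Rightarrow> 'b) \<Rightarrow> ('m \<Rightarrow> 'n) \<Rightarrow>
    'm \<Rightarrow> 'm \<Rightarrow> 'm \<Rightarrow> 'm \<Rightarrow> bool" where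
  "composition_legs E B po pa h1 v2 w k \<longleftrightarrow>
     latent_pullback E k v2 w h1 \<and> subvertical E B po pa w \<and> prone E B po pa k"

end

theory Submission
  imports Defs
begin

text \<open>A span \<open>(v, h)\<close> from \<open>X\<close> to \<open>Y\<close> is represented by the relation
  \<open>{(t v, t h) | t. t (Rst v) = t}\<close> between arrows into \<open>X\<close> and arrows into \<open>Y\<close>.  Since \<open>h\<close> is
  prone, \<open>t\<close> is determined by \<open>t h\<close> and \<open>p t = p (t v)\<close>; this makes the relation a complete
  invariant of the equivalence class.  The universal property of a latent pullback says exactly
  that composing spans composes the relations, so well-definedness and associativity of the
  composition come for free.  The restriction of a span over \<open>f\<close> becomes the identity relation on
  the arrows \<open>t\<close> with \<open>p t (Rst f) = p t\<close>, and R.1--R.4 reduce to the laws of the base.\<close>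

text \<open>Arguing with spans directly would call for a comparison isomorphism between iterated
  latent pullbacks in every law. The passage to relations avoids this: sending \<open>X\<close> to
  the set of arrows into \<open>X\<close> and a class to its relation is a faithful functor to sets
  and relations, so an equation of classes needs no isomorphism to be exhibited.

  Hyperconnectedness enters mainly through injectivity: arrows with a common domain have equal
  restrictions as soon as their images do. Preciseness, and absorption of a restriction idempotent,
  can therefore be tested in the base. Surjectivity serves only to make \<open>hat\<close> exist.

  Two obstacles shape the details. Since \<open>p\<close> is a semifunctor,
  \<open>pa (Id E X)\<close> is merely a restriction idempotent, so the side condition of
  \<open>prone_lift\<close> has to be proved. And the image of a leg \<open>k\<close> is visible
  only for the latent pullback built from a prone lift; for arbitrary legs the image of the
  composite comes from the invariance of the relation.\<close>

lemma Id_on_relcomp: "(\<And>m g. (m, g) \<in> r \<Longrightarrow> m \<in> S) \<Longrightarrow> Id_on S O r = r"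
  by (auto simp: Id_on_def relcomp_unfold)

lemma relcomp_Id_on: "(\<And>m g. (m, g) \<in> r \<Longrightarrow> g \<in> S) \<Longrightarrow> r O Id_on S = r"
  by (auto simp: Id_on_def relcomp_unfold)

text \<open>Relational form of R.4: testing the output against \<open>S\<close> is the same as
  testing the input against \<open>T\<close>.\<close>

lemma relcomp_Id_on_commute:
  "(\<And>m g. (m, g) \<in> r \<Longrightarrow> g \<in> S \<longleftrightarrow> m \<in> T) \<Longrightarrow> r O Id_on S = Id_on T O r"
  by (auto simp: Id_on_def relcomp_unfold)

section \<open>Restriction categories\<close>

context category
begin

lemma arr_hom: "f \<in> Arr C \<Longrightarrow> f \<in> hom C (Dom C f) (Cod C f)"
  by (simp add: hom_def)

lemma Comp_arr [simp]:
  assumes "f \<in> Arr C" "g \<in> Arr C" "Cod C f = Dom C g"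
  shows "f \<cdot> g \<in> Arr C" "Dom C (f \<cdot> g) = Dom C f" "Cod C (f \<cdot> g) = Cod C g"
  using Comp_hom[of f "Dom C f" "Cod C f" g "Cod C g"] assms by (simp_all add: hom_def)

lemma Id_arr [simp]:
  assumes "X \<in> Obj C"
  shows "Id C X \<in> Arr C" "Dom C (Id C X) = X" "Cod C (Id C X) = X"
  using Id_hom[OF assms] by (simp_all add: hom_def)

lemma Id_Comp [simp]: "f \<in> Arr C \<Longrightarrow> X = Dom C f \<Longrightarrow> Id C X \<cdot> f = f"
  using Id_left arr_hom by blast

lemma Comp_Id [simp]: "f \<in> Arr C \<Longrightarrow> X = Cod C f \<Longrightarrow> f \<cdot> Id C X = f"
  using Id_right arr_hom by blast

lemma assoc [simp]:
  assumes "f \<in> Arr C" "g \<in> Arr C" "h \<in> Arr C" "Cod C f = Dom C g" "Cod C g = Dom C h"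
  shows "f \<cdot> g \<cdot> h = f \<cdot> (g \<cdot> h)"
  using Comp_assoc[of f "Dom C f" "Dom C g" g "Dom C h" h "Cod C h"] assms by (simp add: hom_def)

end

context restriction_category
begin

lemma Rst_arr [simp]:
  assumes "f \<in> Arr C"
  shows "Rst C f \<in> Arr C" "Dom C (Rst C f) = Dom C f" "Cod C (Rst C f) = Dom C f"
  using Rst_hom[OF arr_hom[OF assms]] by (simp_all add: hom_def)

lemma Rst_Comp_self [simp]: "f \<in> Arr C \<Longrightarrow> Rst C f \<cdot> f = f"
  using R1 arr_hom by blast

lemma Rst_commute:
  "f \<in> Arr C \<Longrightarrow> g \<in> Arr C \<Longrightarrow> Dom C f = Dom C g \<Longrightarrow> Rst C f \<cdot> Rst C g = Rst C g \<cdot> Rst C f"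
  using R2 arr_hom by metis

lemma Rst_Rst_Comp:
  "f \<in> Arr C \<Longrightarrow> g \<in> Arr C \<Longrightarrow> Dom C f = Dom C g \<Longrightarrow> Rst C (Rst C f \<cdot> g) = Rst C f \<cdot> Rst C g"
  using R3 arr_hom by metis

lemma Comp_Rst:
  "f \<in> Arr C \<Longrightarrow> g \<in> Arr C \<Longrightarrow> Cod C f = Dom C g \<Longrightarrow> f \<cdot> Rst C g = Rst C (f \<cdot> g) \<cdot> f"
  using R4 arr_hom by metis

lemma Rst_Id [simp]:
  assumes "X \<in> Obj C"
  shows "Rst C (Id C X) = Id C X"
  using Rst_Comp_self[of "Id C X"] Comp_Id[of "Rst C (Id C X)" X] assms by simp

lemma Rst_idem [simp]: "f \<in> Arr C \<Longrightarrow> Rst C f \<cdot> Rst C f = Rst C f"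
  using Rst_Rst_Comp[of f f] by simp

lemma Rst_Rst [simp]:
  assumes "f \<in> Arr C"
  shows "Rst C (Rst C f) = Rst C f"
  using Rst_Rst_Comp[of f "Id C (Dom C f)"] assms Dom_Obj[OF assms] by simp

lemma Rst_Comp_Comp [simp]:
  assumes "f \<in> Arr C" "g \<in> Arr C" "Cod C f = Dom C g"
  shows "Rst C f \<cdot> (f \<cdot> g) = f \<cdot> g"
  using assoc[of "Rst C f" f g] assms by simp

lemma Rst_Rst_Comp_self:
  assumes "f \<in> Arr C" "g \<in> Arr C" "Cod C f = Dom C g"
  shows "Rst C f \<cdot> Rst C (f \<cdot> g) = Rst C (f \<cdot> g)"
  using Rst_Rst_Comp[of f "f \<cdot> g"] assms by simp

lemma Rst_Comp_Rst:
  assumes "f \<in> Arr C" "g \<in> Arr C" "Cod C f = Dom C g"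
  shows "Rst C (f \<cdot> Rst C g) = Rst C (f \<cdot> g)"
proof -
  have "Rst C (f \<cdot> Rst C g) = Rst C (Rst C (f \<cdot> g) \<cdot> f)"
    using assms by (simp only: Comp_Rst)
  also have "\<dots> = Rst C f \<cdot> Rst C (f \<cdot> g)"
    using assms Rst_Rst_Comp[of "f \<cdot> g" f] Rst_commute[of f "f \<cdot> g"] by simp
  finally show ?thesis
    using assms by (simp only: Rst_Rst_Comp_self)
qed

text \<open>By R.4 the left side says that restricting \<open>f\<close> to the domain of
  \<open>f g\<close> loses nothing. This is the bridge between the absorption conditions of latent
  pullbacks and preciseness.\<close>

lemma Comp_Rst_eq_iff:
  assumes "f \<in> Arr C" "g \<in> Arr C" "Cod C f = Dom C g"
  shows "f \<cdot> Rst C g = f \<longleftrightarrow> Rst C (f \<cdot> g) = Rst C f"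
  using Comp_Rst[OF assms] Rst_Comp_Rst[OF assms] assms(1) by auto

text \<open>Restrictions satisfy \<open>Rst (f g h)\<close> \<le> \<open>Rst (f g)\<close> \<le>
  \<open>Rst f\<close>, so equality of the outer terms squeezes the middle one.\<close>

lemma Rst_Comp_le:
  assumes "f \<in> Arr C" "g \<in> Arr C" "h \<in> Arr C" "Cod C f = Dom C g" "Cod C g = Dom C h"
    and "Rst C (f \<cdot> (g \<cdot> h)) = Rst C f"
  shows "Rst C (f \<cdot> g) = Rst C f"
proof -
  have "Rst C (f \<cdot> g) = Rst C f \<cdot> Rst C (f \<cdot> g)"
    using assms by (simp only: Rst_Rst_Comp_self)
  also have "\<dots> = Rst C (f \<cdot> g) \<cdot> Rst C (f \<cdot> g \<cdot> h)"
    using assms Rst_commute[of f "f \<cdot> g"] by simp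
  also have "\<dots> = Rst C f"
    using assms Rst_Rst_Comp_self[of "f \<cdot> g" h] by simp
  finally show ?thesis .
qed

text \<open>Antisymmetry of the restriction order: R.3 makes both restrictions equal to their
  product, after which R.1 applies.\<close>

lemma Rst_Comp_antisym:
  assumes "f \<in> Arr C" "g \<in> Arr C" "Dom C f = Dom C g" "Rst C f \<cdot> g = f" "Rst C g \<cdot> f = g"
  shows "f = g"
  using assms(4,5) Rst_Rst_Comp[OF assms(1-3)] Rst_Rst_Comp[OF assms(2,1) assms(3)[symmetric]]
    Rst_commute[OF assms(1-3)] Rst_Comp_self[OF assms(2)]
  by metis

end

section \<open>Semifunctors and prone arrows\<close>

context restriction_semifunctor
begin

lemma pa_arr [simp]:
  assumes "f \<in> Arr E"
  shows "pa f \<in> Arr B" "Dom B (pa f) = po (Dom E f)" "Cod B (pa f) = po (Cod E f)"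
  using pa_hom[OF E.arr_hom[OF assms]] by (simp_all add: hom_def)

lemma pa_Comp' [simp]:
  "f \<in> Arr E \<Longrightarrow> g \<in> Arr E \<Longrightarrow> Cod E f = Dom E g \<Longrightarrow> pa (f \<cdot>\<^bsub>E\<^esub> g) = pa f \<cdot>\<^bsub>B\<^esub> pa g"
  using pa_Comp E.arr_hom by metis

lemma pa_Rst' [simp]: "f \<in> Arr E \<Longrightarrow> pa (Rst E f) = Rst B (pa f)"
  using pa_Rst E.arr_hom by blast

lemma subvertical_iff:
  "subvertical E B po pa v \<longleftrightarrow>
     v \<in> Arr E \<and> po (Dom E v) = po (Cod E v) \<and> Rst B (pa v) = pa v"
  unfolding subvertical_def restriction_idempotents_def hom_def by auto

lemma prone_arr: "prone E B po pa f \<Longrightarrow> f \<in> Arr E"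
  by (simp add: prone_def)

text \<open>Existence half of proneness with the hom-sets unpacked. Preciseness of the lift is
  dropped because hyperconnectedness restores it from \<open>pa k = u\<close>.\<close>

lemma prone_ex:
  assumes "prone E B po pa f" "g \<in> Arr E" "Cod E g = Cod E f"
    and "u \<in> Arr B" "Dom B u = po (Dom E g)" "Cod B u = po (Dom E f)"
    and "u \<cdot>\<^bsub>B\<^esub> pa f = pa g" "Rst B (pa g) = Rst B u"
  obtains k where "k \<in> Arr E" "Dom E k = Dom E g" "Cod E k = Dom E f" "pa k = u" "k \<cdot>\<^bsub>E\<^esub> f = g"
proof -
  have "g \<in> hom E (Dom E g) (Cod E f)" "u \<in> hom B (po (Dom E g)) (po (Dom E f))"
    using assms by (simp_all add: hom_def)
  moreover have "precise B u (pa f) (pa g)"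
    using assms prone_arr by (simp add: precise_def)
  ultimately have "\<exists>k. k \<in> hom E (Dom E g) (Dom E f) \<and> pa k = u \<and> precise E k f g"
    using assms E.Dom_Obj unfolding prone_def by blast
  then show thesis
    using that unfolding precise_def hom_def by blast
qed

end

section \<open>Proneness and restriction idempotents under hyperconnectedness\<close>

context latent_hyperfibration
begin

text \<open>Injectivity on the restriction idempotents of the common domain. This is how equations
  between restrictions are brought down to the base.\<close>

lemma Rst_eq_of_pa:
  assumes "f \<in> Arr E" "g \<in> Arr E" "Dom E f = Dom E g" "Rst B (pa f) = Rst B (pa g)"
  shows "Rst E f = Rst E g"
proof (rule inj_onD)
  show "inj_on pa (restriction_idempotents E (Dom E f))"
    using hyperconnected[OF E.Dom_Obj] assms(1) bij_betw_imp_inj_on by blast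
qed (use assms in \<open>auto simp: restriction_idempotents_def hom_def\<close>)

text \<open>Uniqueness half of proneness, as a cancellation law. Preciseness is asked of
  \<open>k\<close> only: \<open>k'\<close> has the same image, hence the same restriction.\<close>

lemma prone_cancel:
  assumes "prone E B po pa f" "k \<in> Arr E" "k' \<in> Arr E" "Dom E k = Dom E k'"
    and "Cod E k = Dom E f" "Cod E k' = Dom E f" "pa k = pa k'"
    and "k \<cdot>\<^bsub>E\<^esub> f = k' \<cdot>\<^bsub>E\<^esub> f" "Rst E (k \<cdot>\<^bsub>E\<^esub> f) = Rst E k"
  shows "k = k'"
proof -
  let ?g = "k \<cdot>\<^bsub>E\<^esub> f"
  have f: "f \<in> Arr E"
    using assms(1) by (rule prone_arr)
  have R: "Rst E ?g = Rst E k" "Rst E k' = Rst E k"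
    using assms Rst_eq_of_pa[of k' k] by auto
  have "\<exists>!l. l \<in> hom E (Dom E k) (Dom E f) \<and> pa l = pa k \<and> precise E l f ?g"
  proof -
    have "?g \<in> hom E (Dom E k) (Cod E f)" "pa k \<in> hom B (po (Dom E k)) (po (Dom E f))"
      using assms f by (simp_all add: hom_def)
    moreover have "precise B (pa k) (pa f) (pa ?g)"
      using assms(2,5) f R(1) pa_Rst'[of ?g] pa_Rst'[of k] by (simp add: precise_def)
    ultimately show ?thesis
      using assms(1,2) E.Dom_Obj unfolding prone_def by blast
  qed
  moreover have "precise E k f ?g" "precise E k' f ?g"
    using assms f R by (simp_all add: precise_def)
  moreover have "k \<in> hom E (Dom E k) (Dom E f)" "k' \<in> hom E (Dom E k) (Dom E f)"
    using assms by (simp_all add: hom_def)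
  ultimately show ?thesis
    using assms(7) by metis
qed

text \<open>The lift in \<open>ex\<close> comes without preciseness, because
  \<open>Rst E k = Rst E g\<close> can be read off in the base from \<open>pa k = u\<close>.\<close>

lemma proneI:
  assumes f: "f \<in> Arr E"
    and ex: "\<And>g u. g \<in> Arr E \<Longrightarrow> Cod E g = Cod E f \<Longrightarrow> u \<in> Arr B \<Longrightarrow> Dom B u = po (Dom E g) \<Longrightarrow>
      Cod B u = po (Dom E f) \<Longrightarrow> u \<cdot>\<^bsub>B\<^esub> pa f = pa g \<Longrightarrow> Rst B (pa g) = Rst B u \<Longrightarrow>
      \<exists>k \<in> Arr E. Dom E k = Dom E g \<and> Cod E k = Dom E f \<and> pa k = u \<and> k \<cdot>\<^bsub>E\<^esub> f = g"
    and uniq: "\<And>k k'. k \<in> Arr E \<Longrightarrow> k' \<in> Arr E \<Longrightarrow> Dom E k = Dom E k' \<Longrightarrow> Cod E k = Dom E f \<Longrightarrow>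
      Cod E k' = Dom E f \<Longrightarrow> pa k = pa k' \<Longrightarrow> k \<cdot>\<^bsub>E\<^esub> f = k' \<cdot>\<^bsub>E\<^esub> f \<Longrightarrow>
      Rst E (k \<cdot>\<^bsub>E\<^esub> f) = Rst E k \<Longrightarrow> Rst E (k \<cdot>\<^bsub>E\<^esub> f) = Rst E k' \<Longrightarrow> k = k'"
  shows "prone E B po pa f"
  unfolding prone_def
proof (intro conjI ballI impI ex_ex1I f)
  fix Y g u
  assume g: "g \<in> hom E Y (Cod E f)" and u: "u \<in> hom B (po Y) (po (Dom E f))"
    and pr: "precise B u (pa f) (pa g)"
  obtain k where "k \<in> Arr E" "Dom E k = Dom E g" "Cod E k = Dom E f" "pa k = u" "k \<cdot>\<^bsub>E\<^esub> f = g"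
    using ex[of g u] g u pr unfolding hom_def precise_def by auto
  then show "\<exists>k. k \<in> hom E Y (Dom E f) \<and> pa k = u \<and> precise E k f g"
    using g pr f Rst_eq_of_pa[of g k] unfolding hom_def precise_def by auto
next
  fix Y g u k k'
  assume "k \<in> hom E Y (Dom E f) \<and> pa k = u \<and> precise E k f g"
    and "k' \<in> hom E Y (Dom E f) \<and> pa k' = u \<and> precise E k' f g"
  then show "k = k'"
    using uniq[of k k'] unfolding hom_def precise_def by auto
qed

lemma prone_Comp:
  assumes k: "prone E B po pa k" and h: "prone E B po pa h" and kh: "Cod E k = Dom E h"
  shows "prone E B po pa (k \<cdot>\<^bsub>E\<^esub> h)"
proof (rule proneI)
  note arr [simp] = prone_arr[OF k] prone_arr[OF h] kh
  show "k \<cdot>\<^bsub>E\<^esub> h \<in> Arr E"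
    by simp
  fix g u
  assume g: "g \<in> Arr E" "Cod E g = Cod E (k \<cdot>\<^bsub>E\<^esub> h)"
    and u: "u \<in> Arr B" "Dom B u = po (Dom E g)" "Cod B u = po (Dom E (k \<cdot>\<^bsub>E\<^esub> h))"
    and eq: "u \<cdot>\<^bsub>B\<^esub> pa (k \<cdot>\<^bsub>E\<^esub> h) = pa g" "Rst B (pa g) = Rst B u"
  \<comment> \<open>The lift is taken through \<open>h\<close> first, over \<open>u\<close> followed
    by \<open>pa k\<close>. That triangle is precise because the restriction of its left factor is
    squeezed between those of \<open>u\<close> and of the full composite.\<close>
  have R: "Rst B (u \<cdot>\<^bsub>B\<^esub> pa k) = Rst B u"
    using B.Rst_Comp_le[of u "pa k" "pa h"] u eq by simp
  obtain l where l: "l \<in> Arr E" "Dom E l = Dom E g" "Cod E l = Dom E h" "pa l = u \<cdot>\<^bsub>B\<^esub> pa k"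
      "l \<cdot>\<^bsub>E\<^esub> h = g"
    by (rule prone_ex[OF h, of g "u \<cdot>\<^bsub>B\<^esub> pa k"]) (use g u eq R in simp_all)
  obtain j where "j \<in> Arr E" "Dom E j = Dom E l" "Cod E j = Dom E k" "pa j = u" "j \<cdot>\<^bsub>E\<^esub> k = l"
    by (rule prone_ex[OF k, of l u]) (use l g u eq R in simp_all)
  then show "\<exists>j \<in> Arr E. Dom E j = Dom E g \<and> Cod E j = Dom E (k \<cdot>\<^bsub>E\<^esub> h) \<and> pa j = u \<and>
      j \<cdot>\<^bsub>E\<^esub> (k \<cdot>\<^bsub>E\<^esub> h) = g"
    using l E.assoc[of j k h] by (intro bexI[of _ j]) auto
next
  note arr [simp] = prone_arr[OF k] prone_arr[OF h] kh
  fix j j'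
  assume j [simp]: "j \<in> Arr E" "j' \<in> Arr E" "Dom E j = Dom E j'"
    and "Cod E j = Dom E (k \<cdot>\<^bsub>E\<^esub> h)" "Cod E j' = Dom E (k \<cdot>\<^bsub>E\<^esub> h)"
    and eq: "pa j = pa j'" "j \<cdot>\<^bsub>E\<^esub> (k \<cdot>\<^bsub>E\<^esub> h) = j' \<cdot>\<^bsub>E\<^esub> (k \<cdot>\<^bsub>E\<^esub> h)"
      "Rst E (j \<cdot>\<^bsub>E\<^esub> (k \<cdot>\<^bsub>E\<^esub> h)) = Rst E j"
  then have c [simp]: "Cod E j = Dom E k" "Cod E j' = Dom E k"
    by simp_all
  have R: "Rst E (j \<cdot>\<^bsub>E\<^esub> k) = Rst E j"
    by (rule E.Rst_Comp_le[of j k h]) (use eq in simp_all)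
  have jk: "j \<cdot>\<^bsub>E\<^esub> k = j' \<cdot>\<^bsub>E\<^esub> k"
    by (rule prone_cancel[OF h]) (use eq R in simp_all)
  show "j = j'"
    by (rule prone_cancel[OF k]) (use eq R jk in simp_all)
qed

text \<open>A precise triangle over \<open>pa e\<close> forces its left factor to absorb
  \<open>pa e\<close>, so \<open>u = pa g\<close>. Then \<open>g\<close> absorbs \<open>e\<close> by
  comparison of restrictions in the base, and \<open>g\<close> is its own lift.\<close>

lemma prone_restriction_idempotent:
  assumes e: "e \<in> Arr E" "Rst E e = e" "Dom E e = Cod E e"
  shows "prone E B po pa e"
proof (rule proneI)
  note [simp] = e(1) e(3)
  fix g u
  assume g: "g \<in> Arr E" "Cod E g = Cod E e"
    and u: "u \<in> Arr B" "Dom B u = po (Dom E g)" "Cod B u = po (Dom E e)"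
    and eq: "u \<cdot>\<^bsub>B\<^esub> pa e = pa g" "Rst B (pa g) = Rst B u"
  have pe: "Rst B (pa e) = pa e"
    using e pa_Rst' by metis
  have "u \<cdot>\<^bsub>B\<^esub> Rst B (pa e) = u"
    using B.Comp_Rst_eq_iff[of u "pa e"] u eq by simp
  then have pg: "pa g = u"
    using pe eq by simp
  have "Rst E (g \<cdot>\<^bsub>E\<^esub> e) = Rst E g"
    using g eq pg by (intro Rst_eq_of_pa) simp_all
  then have "g \<cdot>\<^bsub>E\<^esub> e = g"
    using E.Comp_Rst_eq_iff[of g e] g e by simp
  then show "\<exists>k \<in> Arr E. Dom E k = Dom E g \<and> Cod E k = Dom E e \<and> pa k = u \<and> k \<cdot>\<^bsub>E\<^esub> e = g"
    using g pg by auto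
next
  fix k k'
  assume "k \<in> Arr E" "k' \<in> Arr E" "Dom E k = Dom E k'" "Cod E k = Dom E e" "Cod E k' = Dom E e"
    and "k \<cdot>\<^bsub>E\<^esub> e = k' \<cdot>\<^bsub>E\<^esub> e" "Rst E (k \<cdot>\<^bsub>E\<^esub> e) = Rst E k" "Rst E (k \<cdot>\<^bsub>E\<^esub> e) = Rst E k'"
  then show "k = k'"
    using E.Comp_Rst_eq_iff[of k e] E.Comp_Rst_eq_iff[of k' e] e by simp
qed (use e in simp)

text \<open>Surjectivity of the hyperconnectedness bijection supplies the idempotent; injectivity
  makes the definite description legitimate.\<close>

lemma hat:
  assumes "subvertical E B po pa v"
  shows "hat E pa v \<in> Arr E" "Dom E (hat E pa v) = Cod E v" "Cod E (hat E pa v) = Cod E v"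
    "Rst E (hat E pa v) = hat E pa v" "pa (hat E pa v) = pa v"
proof -
  have v: "v \<in> Arr E" "po (Dom E v) = po (Cod E v)" "Rst B (pa v) = pa v"
    using assms by (simp_all add: subvertical_iff)
  let ?I = "restriction_idempotents E (Cod E v)"
  \<comment> \<open>As \<open>p\<close> may fail to preserve identities, absorption of
    \<open>pa (Id E (Cod E v))\<close> is inherited from the identity law in
    \<open>E\<close>.\<close>
  have "pa v \<cdot>\<^bsub>B\<^esub> pa (Id E (Cod E v)) = pa (v \<cdot>\<^bsub>E\<^esub> Id E (Cod E v))"
    by (rule pa_Comp'[symmetric]) (use v E.Cod_Obj in simp_all)
  then have mem: "pa v \<in> {d \<in> restriction_idempotents B (po (Cod E v)).
      d \<cdot>\<^bsub>B\<^esub> pa (Id E (Cod E v)) = d}"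
    using v by (simp add: restriction_idempotents_def hom_def)
  have bij: "bij_betw pa ?I {d \<in> restriction_idempotents B (po (Cod E v)).
      d \<cdot>\<^bsub>B\<^esub> pa (Id E (Cod E v)) = d}"
    using v E.Cod_Obj by (intro hyperconnected) simp
  have "\<exists>!e. e \<in> ?I \<and> pa e = pa v"
  proof -
    obtain e where "e \<in> ?I" "pa e = pa v"
      using bij_betw_imp_surj_on[OF bij] mem by (metis (no_types, lifting) imageE)
    then show ?thesis
      using inj_onD[OF bij_betw_imp_inj_on[OF bij]] by (intro ex1I[of _ e]) auto
  qed
  then have "hat E pa v \<in> ?I \<and> pa (hat E pa v) = pa v"
    unfolding hat_def by (rule theI')
  then show "hat E pa v \<in> Arr E" "Dom E (hat E pa v) = Cod E v" "Cod E (hat E pa v) = Cod E v"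
    "Rst E (hat E pa v) = hat E pa v" "pa (hat E pa v) = pa v"
    by (simp_all add: restriction_idempotents_def hom_def)
qed

section \<open>Latent pullbacks\<close>

text \<open>\<open>k\<close> is a prone lift of the base composite, and \<open>w\<close> is the lift
  of \<open>k v\<close> through \<open>h\<close>. The image of \<open>k\<close> is recorded because
  \<open>pa_legs\<close> evaluates it for this particular choice.\<close>

lemma composition_legs_exist:
  assumes h: "prone E B po pa h" and v: "subvertical E B po pa v" and hv: "Cod E h = Cod E v"
  shows "\<exists>w k. composition_legs E B po pa h v w k \<and> pa k = pa h \<cdot>\<^bsub>B\<^esub> pa v"
proof -
  have [simp]: "h \<in> Arr E" "v \<in> Arr E" "Cod E h = Cod E v" "po (Dom E v) = po (Cod E v)"
    using h v hv prone_arr by (auto simp: subvertical_iff)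
  have Rv: "Rst B (pa v) = pa v"
    using v by (simp add: subvertical_iff)
  then have vv: "pa v \<cdot>\<^bsub>B\<^esub> pa v = pa v"
    using B.Rst_idem[of "pa v"] by simp
  let ?f = "pa h \<cdot>\<^bsub>B\<^esub> pa v"
  \<comment> \<open>Side condition of \<open>prone_lift\<close>: \<open>pa v\<close> equals
    \<open>pa (Rst E v)\<close>, and \<open>Rst E v\<close> absorbs the identity in
    \<open>E\<close>.\<close>
  have "pa v \<cdot>\<^bsub>B\<^esub> pa (Id E (Dom E v)) = pa v"
    using pa_Comp'[of "Rst E v" "Id E (Dom E v)"] E.Dom_Obj[of v] Rv by simp
  then have "\<exists>k. prone E B po pa k \<and> Cod E k = Dom E v \<and> pa k = ?f"
    by (intro prone_lift[of "Dom E v" "po (Dom E h)"])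
      (use E.Dom_Obj po_Obj in \<open>simp_all add: hom_def\<close>)
  then obtain k where k: "prone E B po pa k" and k' [simp]: "Cod E k = Dom E v" "pa k = ?f"
    by blast
  have k_arr [simp]: "k \<in> Arr E"
    using k by (rule prone_arr)
  have Dk [simp]: "po (Dom E k) = po (Dom E h)"
    using pa_arr(2)[OF k_arr] by simp
  \<comment> \<open>R.4 in the base: restricting \<open>pa h\<close> to the domain of
    \<open>?f\<close> has the same effect as composing with \<open>pa v\<close>. So
    \<open>k v\<close> factors precisely through \<open>h\<close> over a restriction idempotent,
    which makes \<open>w\<close> subvertical.\<close>
  have R: "Rst B ?f \<cdot>\<^bsub>B\<^esub> pa h = ?f"
    using B.Comp_Rst[of "pa h" "pa v"] Rv by simp
  obtain w where w [simp]: "w \<in> Arr E" "Dom E w = Dom E k" "Cod E w = Dom E h"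
      "pa w = Rst B ?f" "w \<cdot>\<^bsub>E\<^esub> h = k \<cdot>\<^bsub>E\<^esub> v"
    by (rule prone_ex[OF h, of "k \<cdot>\<^bsub>E\<^esub> v" "Rst B ?f"]) (use R vv in simp_all)
  have "subvertical E B po pa w"
    by (simp add: subvertical_iff)
  moreover have "latent_pullback E k v w h"
    unfolding latent_pullback_def
  proof (intro conjI ballI impI)
    have "Rst E (k \<cdot>\<^bsub>E\<^esub> v) = Rst E k"
      by (rule Rst_eq_of_pa) (use vv in simp_all)
    then show kv: "k \<cdot>\<^bsub>E\<^esub> Rst E v = k"
      using E.Comp_Rst_eq_iff[of k v] by simp
    have "Rst E (w \<cdot>\<^bsub>E\<^esub> h) = Rst E w"
      by (rule Rst_eq_of_pa) (use vv in simp_all)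
    then show wh: "w \<cdot>\<^bsub>E\<^esub> Rst E h = w"
      using E.Comp_Rst_eq_iff[of w h] by simp
    have Rwk: "Rst E w = Rst E k"
      by (rule Rst_eq_of_pa) simp_all
    fix X x0 x1 e
    assume X: "X \<in> Obj E" and x0: "x0 \<in> hom E X (Dom E v)" and x1: "x1 \<in> hom E X (Dom E h)"
      and e: "e \<in> restriction_idempotents E X"
      and *: "e \<cdot>\<^bsub>E\<^esub> x1 \<cdot>\<^bsub>E\<^esub> h = e \<cdot>\<^bsub>E\<^esub> x0 \<cdot>\<^bsub>E\<^esub> v \<and> rle E e (Rst E (x1 \<cdot>\<^bsub>E\<^esub> h)) \<and>
        rle E e (Rst E (x0 \<cdot>\<^bsub>E\<^esub> v))"
    have [simp]: "x0 \<in> Arr E" "Dom E x0 = X" "Cod E x0 = Dom E v"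
        "x1 \<in> Arr E" "Dom E x1 = X" "Cod E x1 = Dom E h" "e \<in> Arr E" "Dom E e = X" "Cod E e = X"
      using x0 x1 e by (simp_all add: hom_def restriction_idempotents_def)
    have Re: "Rst E e = e"
      using e by (simp add: restriction_idempotents_def)
    have ee: "e \<cdot>\<^bsub>E\<^esub> e = e"
      using E.Rst_idem[of e] Re by simp
    have sq: "(e \<cdot>\<^bsub>E\<^esub> x1) \<cdot>\<^bsub>E\<^esub> h = (e \<cdot>\<^bsub>E\<^esub> x0) \<cdot>\<^bsub>E\<^esub> v"
      using * by blast
    have R1: "Rst E ((e \<cdot>\<^bsub>E\<^esub> x1) \<cdot>\<^bsub>E\<^esub> h) = e"
      using * E.Rst_Rst_Comp[of e "x1 \<cdot>\<^bsub>E\<^esub> h"] Re unfolding rle_def by simp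
    then have R0: "Rst E ((e \<cdot>\<^bsub>E\<^esub> x0) \<cdot>\<^bsub>E\<^esub> v) = e"
      using sq by simp
    have tot: "Rst E (e \<cdot>\<^bsub>E\<^esub> x) = e"
      if [simp]: "x \<in> Arr E" "y \<in> Arr E" "Dom E x = X" "Cod E x = Dom E y"
        and "Rst E ((e \<cdot>\<^bsub>E\<^esub> x) \<cdot>\<^bsub>E\<^esub> y) = e" for x y
      using E.Rst_Comp_le[of e x y] that Re by simp
    have Rx1: "Rst E (e \<cdot>\<^bsub>E\<^esub> x1) = e" and Rx0: "Rst E (e \<cdot>\<^bsub>E\<^esub> x0) = e"
      using tot[of x1 h] tot[of x0 v] R0 R1 by simp_all
    have x0v: "(e \<cdot>\<^bsub>E\<^esub> x0) \<cdot>\<^bsub>E\<^esub> Rst E v = e \<cdot>\<^bsub>E\<^esub> x0"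
      using E.Comp_Rst_eq_iff[of "e \<cdot>\<^bsub>E\<^esub> x0" v] R0 Rx0 by simp
    \<comment> \<open>\<open>pa v\<close> and \<open>pa (Rst E v)\<close> coincide, so an arrow that
      absorbs \<open>Rst E v\<close> keeps its image after composition with
      \<open>v\<close>.\<close>
    have pv: "pa ((e \<cdot>\<^bsub>E\<^esub> x0) \<cdot>\<^bsub>E\<^esub> v) = pa (e \<cdot>\<^bsub>E\<^esub> x0)"
    proof -
      have "pa ((e \<cdot>\<^bsub>E\<^esub> x0) \<cdot>\<^bsub>E\<^esub> v) = pa ((e \<cdot>\<^bsub>E\<^esub> x0) \<cdot>\<^bsub>E\<^esub> Rst E v)"
        using Rv by (subst (1 2) pa_Comp') simp_all
      then show ?thesis
        using x0v by simp
    qed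
    have pf: "pa (e \<cdot>\<^bsub>E\<^esub> x1) \<cdot>\<^bsub>B\<^esub> ?f = pa (e \<cdot>\<^bsub>E\<^esub> x0)"
    proof -
      have "pa (e \<cdot>\<^bsub>E\<^esub> x1) \<cdot>\<^bsub>B\<^esub> ?f = pa ((e \<cdot>\<^bsub>E\<^esub> x1) \<cdot>\<^bsub>E\<^esub> h) \<cdot>\<^bsub>B\<^esub> pa v"
        by simp
      also have "\<dots> = pa ((e \<cdot>\<^bsub>E\<^esub> x0) \<cdot>\<^bsub>E\<^esub> v) \<cdot>\<^bsub>B\<^esub> pa v"
        by (simp only: sq)
      also have "\<dots> = pa (e \<cdot>\<^bsub>E\<^esub> x0) \<cdot>\<^bsub>B\<^esub> pa v"
        by (simp only: pv)
      also have "\<dots> = pa ((e \<cdot>\<^bsub>E\<^esub> x0) \<cdot>\<^bsub>E\<^esub> v)"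
        by simp
      finally show ?thesis
        by (simp only: pv)
    qed
    have Rp: "Rst B (pa (e \<cdot>\<^bsub>E\<^esub> x0)) = Rst B (pa (e \<cdot>\<^bsub>E\<^esub> x1))"
      using Rx0 Rx1 pa_Rst'[of "e \<cdot>\<^bsub>E\<^esub> x0"] pa_Rst'[of "e \<cdot>\<^bsub>E\<^esub> x1"] by simp
    \<comment> \<open>The mediating arrow is lifted through \<open>k\<close> alone, over the image
      of \<open>e x1\<close>; its equation with \<open>w\<close> then follows by cancelling the
      prone \<open>h\<close>.\<close>
    obtain j where j [simp]: "j \<in> Arr E" "Dom E j = X" "Cod E j = Dom E k"
      and pj: "pa j = pa (e \<cdot>\<^bsub>E\<^esub> x1)" and jk: "j \<cdot>\<^bsub>E\<^esub> k = e \<cdot>\<^bsub>E\<^esub> x0"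
      by (rule prone_ex[OF k, of "e \<cdot>\<^bsub>E\<^esub> x0" "pa (e \<cdot>\<^bsub>E\<^esub> x1)"]) (use pf Rp in simp_all)
    have Rj: "Rst E j = e"
      using Rst_eq_of_pa[of j "e \<cdot>\<^bsub>E\<^esub> x1"] pj Rx1 by simp
    have jRk: "j \<cdot>\<^bsub>E\<^esub> Rst E k = j"
      by (subst E.Comp_Rst_eq_iff) (use jk Rx0 Rj in simp_all)
    have jw: "j \<cdot>\<^bsub>E\<^esub> w = e \<cdot>\<^bsub>E\<^esub> x1"
    proof (rule prone_cancel[OF h])
      have "pa (j \<cdot>\<^bsub>E\<^esub> w) = pa (j \<cdot>\<^bsub>E\<^esub> Rst E k)"
        by (subst (1 2) pa_Comp') simp_all
      then show "pa (j \<cdot>\<^bsub>E\<^esub> w) = pa (e \<cdot>\<^bsub>E\<^esub> x1)"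
        using jRk pj by simp
      have "(j \<cdot>\<^bsub>E\<^esub> w) \<cdot>\<^bsub>E\<^esub> h = (j \<cdot>\<^bsub>E\<^esub> k) \<cdot>\<^bsub>E\<^esub> v"
        by simp
      also have "\<dots> = (e \<cdot>\<^bsub>E\<^esub> x1) \<cdot>\<^bsub>E\<^esub> h"
        using jk sq by (simp only:)
      finally show "(j \<cdot>\<^bsub>E\<^esub> w) \<cdot>\<^bsub>E\<^esub> h = (e \<cdot>\<^bsub>E\<^esub> x1) \<cdot>\<^bsub>E\<^esub> h" .
      have "(j \<cdot>\<^bsub>E\<^esub> w) \<cdot>\<^bsub>E\<^esub> Rst E h = j \<cdot>\<^bsub>E\<^esub> w"
        using wh by simp
      then show "Rst E ((j \<cdot>\<^bsub>E\<^esub> w) \<cdot>\<^bsub>E\<^esub> h) = Rst E (j \<cdot>\<^bsub>E\<^esub> w)"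
        by (subst (asm) E.Comp_Rst_eq_iff) simp_all
    qed simp_all
    show "\<exists>!j. j \<in> hom E X (Dom E k) \<and> Rst E j = e \<and> rle E (j \<cdot>\<^bsub>E\<^esub> k) x0 \<and>
        rle E (j \<cdot>\<^bsub>E\<^esub> w) x1 \<and> j \<cdot>\<^bsub>E\<^esub> Rst E k = j \<and> j \<cdot>\<^bsub>E\<^esub> Rst E w = j"
    proof (rule ex1I[of _ j])
      show "j \<in> hom E X (Dom E k) \<and> Rst E j = e \<and> rle E (j \<cdot>\<^bsub>E\<^esub> k) x0 \<and>
          rle E (j \<cdot>\<^bsub>E\<^esub> w) x1 \<and> j \<cdot>\<^bsub>E\<^esub> Rst E k = j \<and> j \<cdot>\<^bsub>E\<^esub> Rst E w = j"
        unfolding hom_def rle_def jk jw Rx0 Rx1 using Rj jRk Rwk by simp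
    next
      fix i
      assume i: "i \<in> hom E X (Dom E k) \<and> Rst E i = e \<and> rle E (i \<cdot>\<^bsub>E\<^esub> k) x0 \<and>
          rle E (i \<cdot>\<^bsub>E\<^esub> w) x1 \<and> i \<cdot>\<^bsub>E\<^esub> Rst E k = i \<and> i \<cdot>\<^bsub>E\<^esub> Rst E w = i"
      then have [simp]: "i \<in> Arr E" "Dom E i = X" "Cod E i = Dom E k"
        by (simp_all add: hom_def)
      \<comment> \<open>The absorption conditions give both composites restriction \<open>e\<close>,
        so the two inequalities for the competitor \<open>i\<close> become equations.\<close>
      have "Rst E (i \<cdot>\<^bsub>E\<^esub> k) = e" "Rst E (i \<cdot>\<^bsub>E\<^esub> w) = e"
        using i E.Comp_Rst_eq_iff[of i k] E.Comp_Rst_eq_iff[of i w] by simp_all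
      then have ik: "i \<cdot>\<^bsub>E\<^esub> k = e \<cdot>\<^bsub>E\<^esub> x0" and iw: "i \<cdot>\<^bsub>E\<^esub> w = e \<cdot>\<^bsub>E\<^esub> x1"
        using i unfolding rle_def by metis+
      \<comment> \<open>\<open>w\<close> has the same image as its restriction, so
        \<open>pa i\<close> can be read off from \<open>i w\<close>.\<close>
      have "pa i = pa (i \<cdot>\<^bsub>E\<^esub> Rst E w)"
        using i by simp
      also have "\<dots> = pa (i \<cdot>\<^bsub>E\<^esub> w)"
        by (subst (1 2) pa_Comp') simp_all
      finally have pij: "pa i = pa j"
        using iw pj by simp
      show "i = j"
        by (rule prone_cancel[OF k]) (use i ik jk Rx0 pij in simp_all)
    qed
  qed simp_all
  ultimately show ?thesis
    using k k'(2) unfolding composition_legs_def by blast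
qed

section \<open>Spans as relations\<close>

abbreviation "spn \<equiv> spans E B po pa"
abbreviation "srel \<equiv> span_rel E B po pa"
abbreviation "cls \<equiv> span_class E B po pa"
abbreviation "legs \<equiv> composition_legs E B po pa"

text \<open>A Yoneda-style encoding: \<open>t\<close> ranges over the generalised elements of the
  apex, of any domain, that the legs leave unrestricted.\<close>

definition graph where
  "graph v h =
     {(t \<cdot>\<^bsub>E\<^esub> v, t \<cdot>\<^bsub>E\<^esub> h) | t. t \<in> Arr E \<and> Cod E t = Dom E v \<and> t \<cdot>\<^bsub>E\<^esub> Rst E v = t}"

lemma spans_iff:
  "(v, h) \<in> spn X Y \<longleftrightarrow> subvertical E B po pa v \<and> prone E B po pa h \<and>
     Dom E v = Dom E h \<and> Cod E v = X \<and> Cod E h = Y \<and> Rst E v = Rst E h"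
  by (simp add: spans_def)

lemma spans_arr:
  assumes "(v, h) \<in> spn X Y"
  shows "v \<in> Arr E" "h \<in> Arr E" "Dom E v = Dom E h" "Cod E v = X" "Cod E h = Y"
    "Rst E v = Rst E h" "po (Dom E h) = po X" "Rst B (pa h) = pa v"
proof -
  show *: "v \<in> Arr E" "h \<in> Arr E" "Dom E v = Dom E h" "Cod E v = X" "Cod E h = Y"
      "Rst E v = Rst E h" "po (Dom E h) = po X"
    using assms prone_arr by (auto simp: spans_iff subvertical_iff)
  have "Rst B (pa h) = Rst B (pa v)"
    using * pa_Rst' by metis
  then show "Rst B (pa h) = pa v"
    using assms by (simp add: spans_iff subvertical_iff)
qed

text \<open>The generic pair, obtained from \<open>t = Rst E h\<close>; every other pair of the
  relation arises from it by precomposition.\<close>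

lemma graph_self:
  assumes "(v, h) \<in> spn X Y"
  shows "(v, h) \<in> graph v h"
  unfolding graph_def using spans_arr[OF assms]
  by (auto intro!: exI[of _ "Rst E h"]) (metis E.Rst_Comp_self)

text \<open>Since \<open>pa v\<close> is the restriction of \<open>pa h\<close>, absorbing
  \<open>Rst E v\<close> gives \<open>pa m = pa t\<close>. Hence the whole relation lies over the
  single base arrow \<open>pa h\<close>.\<close>

lemma graph_arr:
  assumes vh: "(v, h) \<in> spn X Y" and mg: "(m, g) \<in> graph v h"
  shows "m \<in> Arr E" "g \<in> Arr E" "Dom E m = Dom E g" "Cod E m = X" "Cod E g = Y"
    "pa m \<cdot>\<^bsub>B\<^esub> pa h = pa g" "Rst B (pa m) = Rst B (pa g)"
proof -
  note a [simp] = spans_arr(1-7)[OF vh]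
  obtain t where t [simp]: "t \<in> Arr E" "Cod E t = Dom E h" and tt: "t \<cdot>\<^bsub>E\<^esub> Rst E h = t"
    and m: "m = t \<cdot>\<^bsub>E\<^esub> v" "g = t \<cdot>\<^bsub>E\<^esub> h"
    using mg unfolding graph_def by auto
  show "m \<in> Arr E" "g \<in> Arr E" "Dom E m = Dom E g" "Cod E m = X" "Cod E g = Y"
    unfolding m by simp_all
  have pt: "pa t \<cdot>\<^bsub>B\<^esub> Rst B (pa h) = pa t"
    using tt pa_Comp'[of t "Rst E h"] by simp
  then have pm: "pa m = pa t"
    unfolding m using spans_arr(8)[OF vh] by simp
  show "pa m \<cdot>\<^bsub>B\<^esub> pa h = pa g"
    unfolding pm unfolding m by simp
  show "Rst B (pa m) = Rst B (pa g)"
    unfolding pm unfolding m using pt B.Comp_Rst_eq_iff[of "pa t" "pa h"] by simp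
qed

text \<open>Each generic pair occurs in the other relation, so \<open>pa h\<close> and
  \<open>pa h'\<close> lie below each other in the restriction order.\<close>

lemma pa_eq_of_graph_mem:
  assumes s: "(v, h) \<in> spn X Y" and s': "(v', h') \<in> spn X Y"
    and mem: "(v, h) \<in> graph v' h'" "(v', h') \<in> graph v h"
  shows "pa h = pa h'" "pa v = pa v'"
proof -
  have *: "Rst B (pa h) \<cdot>\<^bsub>B\<^esub> pa h' = pa h" "Rst B (pa h') \<cdot>\<^bsub>B\<^esub> pa h = pa h'"
    using graph_arr(6)[OF s' mem(1)] graph_arr(6)[OF s mem(2)] spans_arr(8)[OF s]
      spans_arr(8)[OF s'] by metis+
  show "pa h = pa h'"
    by (rule B.Rst_Comp_antisym[OF _ _ _ *]) (use spans_arr(1-7)[OF s] spans_arr(1-7)[OF s'] in simp_all)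
  then show "pa v = pa v'"
    using spans_arr(8)[OF s] spans_arr(8)[OF s'] by metis
qed

text \<open>An isomorphism acts on the relations by precomposition. Conversely, each generic pair
  occurs in the relation of the other span, which yields arrows \<open>t\<close> and
  \<open>r\<close> both ways; proneness makes them partial inverses.\<close>

lemma span_rel_iff:
  "((v, h), (v', h')) \<in> srel X Y \<longleftrightarrow>
     (v, h) \<in> spn X Y \<and> (v', h') \<in> spn X Y \<and> graph v h = graph v' h'"
proof
  have incl: "graph v h \<subseteq> graph v' h'"
    if "(v, h) \<in> spn X Y" "(v', h') \<in> spn X Y" "a \<in> Arr E" "Dom E a = Dom E v"
      "Cod E a = Dom E v'" "a \<cdot>\<^bsub>E\<^esub> v' = v" "a \<cdot>\<^bsub>E\<^esub> h' = h" for v h v' h' a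
  proof
    note [simp] = spans_arr(1-6)[OF that(1)] spans_arr(1-6)[OF that(2)] that(3-5)
    fix x
    assume "x \<in> graph v h"
    then obtain t where t [simp]: "t \<in> Arr E" "Cod E t = Dom E h" and tt: "t \<cdot>\<^bsub>E\<^esub> Rst E h = t"
      and x: "x = (t \<cdot>\<^bsub>E\<^esub> v, t \<cdot>\<^bsub>E\<^esub> h)"
      unfolding graph_def by auto
    have e: "(t \<cdot>\<^bsub>E\<^esub> a) \<cdot>\<^bsub>E\<^esub> v' = t \<cdot>\<^bsub>E\<^esub> v" "(t \<cdot>\<^bsub>E\<^esub> a) \<cdot>\<^bsub>E\<^esub> h' = t \<cdot>\<^bsub>E\<^esub> h"
      using that(6,7) by simp_all
    have th: "Rst E (t \<cdot>\<^bsub>E\<^esub> (a \<cdot>\<^bsub>E\<^esub> h')) = Rst E t"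
      using tt that(7) E.Comp_Rst_eq_iff[of t h] by simp
    then have "Rst E (t \<cdot>\<^bsub>E\<^esub> a) = Rst E t"
      by (intro E.Rst_Comp_le[of t a h']) simp_all
    then have "(t \<cdot>\<^bsub>E\<^esub> a) \<cdot>\<^bsub>E\<^esub> Rst E v' = t \<cdot>\<^bsub>E\<^esub> a"
      using E.Comp_Rst_eq_iff[of "t \<cdot>\<^bsub>E\<^esub> a" h'] th by simp
    then show "x \<in> graph v' h'"
      unfolding graph_def x using e
      by (intro CollectI exI[of _ "t \<cdot>\<^bsub>E\<^esub> a"]) (metis E.Comp_arr t spans_arr(3) that)
  qed
  assume "((v, h), (v', h')) \<in> srel X Y"
  then obtain a b where ab: "(v, h) \<in> spn X Y" "(v', h') \<in> spn X Y"
      "a \<in> hom E (Dom E v) (Dom E v')" "partial_inverse E a b"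
      "a \<cdot>\<^bsub>E\<^esub> v' = v" "a \<cdot>\<^bsub>E\<^esub> h' = h" "b \<cdot>\<^bsub>E\<^esub> v = v'" "b \<cdot>\<^bsub>E\<^esub> h = h'"
    unfolding span_rel_def by blast
  then have "graph v h \<subseteq> graph v' h'" "graph v' h' \<subseteq> graph v h"
    using incl[of v h v' h' a] incl[of v' h' v h b] unfolding partial_inverse_def hom_def by auto
  then show "(v, h) \<in> spn X Y \<and> (v', h') \<in> spn X Y \<and> graph v h = graph v' h'"
    using ab by auto
next
  have half: "\<exists>t. t \<in> Arr E \<and> Dom E t = Dom E h \<and> Cod E t = Dom E h' \<and> pa t = pa v \<and>
      t \<cdot>\<^bsub>E\<^esub> v' = v \<and> t \<cdot>\<^bsub>E\<^esub> h' = h \<and> Rst E t = Rst E h"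
    if s: "(v, h) \<in> spn X Y" and s': "(v', h') \<in> spn X Y" and sub: "(v, h) \<in> graph v' h'"
    for v h v' h'
  proof -
    note [simp] = spans_arr(1-7)[OF s] spans_arr(1-7)[OF s']
    obtain t where t [simp]: "t \<in> Arr E" "Cod E t = Dom E h'" and tt: "t \<cdot>\<^bsub>E\<^esub> Rst E h' = t"
      and e: "t \<cdot>\<^bsub>E\<^esub> v' = v" "t \<cdot>\<^bsub>E\<^esub> h' = h"
      using sub unfolding graph_def by auto
    have D: "Dom E t = Dom E h"
      using e E.Comp_arr(2)[of t h'] by simp
    have R: "Rst E t = Rst E h"
      using tt E.Comp_Rst_eq_iff[of t h'] e by simp
    \<comment> \<open>\<open>t\<close> absorbs \<open>Rst E h'\<close>, whose image is
      \<open>pa v'\<close>, so its image is that of \<open>t v' = v\<close>.\<close>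
    have "pa t = pa (t \<cdot>\<^bsub>E\<^esub> Rst E h')"
      by (simp only: tt)
    also have "\<dots> = pa (t \<cdot>\<^bsub>E\<^esub> v')"
      using spans_arr(8)[OF s'] by (subst (1 2) pa_Comp') simp_all
    finally have "pa t = pa v"
      by (simp only: e)
    then show ?thesis
      using t D R e by blast
  qed
  assume "(v, h) \<in> spn X Y \<and> (v', h') \<in> spn X Y \<and> graph v h = graph v' h'"
  then have s: "(v, h) \<in> spn X Y" and s': "(v', h') \<in> spn X Y"
    and m: "(v, h) \<in> graph v' h'" "(v', h') \<in> graph v h"
    using graph_self by auto
  note [simp] = spans_arr(1-7)[OF s] spans_arr(1-7)[OF s']
  obtain t where t [simp]: "t \<in> Arr E" "Dom E t = Dom E h" "Cod E t = Dom E h'" "pa t = pa v"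
    and te: "t \<cdot>\<^bsub>E\<^esub> v' = v" "t \<cdot>\<^bsub>E\<^esub> h' = h" "Rst E t = Rst E h"
    using half[OF s s' m(1)] by blast
  obtain r where r [simp]: "r \<in> Arr E" "Dom E r = Dom E h'" "Cod E r = Dom E h" "pa r = pa v'"
    and re: "r \<cdot>\<^bsub>E\<^esub> v = v'" "r \<cdot>\<^bsub>E\<^esub> h = h'" "Rst E r = Rst E h'"
    using half[OF s' s m(2)] by blast
  have Rv: "Rst B (pa v) = pa v" "Rst B (pa v') = pa v'"
    using s s' by (simp_all add: spans_iff subvertical_iff)
  have pv: "pa v = pa v'"
    by (rule pa_eq_of_graph_mem(2)[OF s s' m])
  \<comment> \<open>\<open>t r\<close> and \<open>Rst E t\<close> have the same image, an idempotent
    of the base, and the same composite with the prone \<open>h\<close>. The spans are kept general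
    so that \<open>r t\<close> is covered as well.\<close>
  have inv: "t \<cdot>\<^bsub>E\<^esub> r = Rst E t"
    if s: "(v, h) \<in> spn X Y" and s': "(v', h') \<in> spn X Y"
      and [simp]: "t \<in> Arr E" "Dom E t = Dom E h" "Cod E t = Dom E h'" "pa t = pa v"
      "r \<in> Arr E" "Dom E r = Dom E h'" "Cod E r = Dom E h" "pa r = pa v'" "pa v = pa v'"
      and te: "t \<cdot>\<^bsub>E\<^esub> h' = h" "Rst E t = Rst E h" and re: "r \<cdot>\<^bsub>E\<^esub> h = h'"
    for v h v' h' t r
  proof (rule prone_cancel[symmetric])
    note [simp] = spans_arr(1-7)[OF s] spans_arr(1-7)[OF s']
    have Rv: "Rst B (pa v') = pa v'"
      using s' by (simp add: spans_iff subvertical_iff)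
    show "prone E B po pa h"
      using s by (simp add: spans_iff)
    show "pa (Rst E t) = pa (t \<cdot>\<^bsub>E\<^esub> r)"
      using Rv B.Rst_idem[of "pa v'"] by simp
    show "Rst E t \<cdot>\<^bsub>E\<^esub> h = (t \<cdot>\<^bsub>E\<^esub> r) \<cdot>\<^bsub>E\<^esub> h"
      using te re by simp
    show "Rst E (Rst E t \<cdot>\<^bsub>E\<^esub> h) = Rst E (Rst E t)"
      using te by simp
  qed (use spans_arr(1-7)[OF s] spans_arr(1-7)[OF s'] in simp_all)
  have "t \<cdot>\<^bsub>E\<^esub> r = Rst E t" "r \<cdot>\<^bsub>E\<^esub> t = Rst E r"
    by (fact inv[OF s s' t r pv te(2,3) re(2)] inv[OF s' s r t pv[symmetric] re(2,3) te(2)])+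
  moreover have "subvertical E B po pa t"
    by (simp add: subvertical_iff Rv)
  ultimately have "t \<in> hom E (Dom E v) (Dom E v') \<and> subvertical E B po pa t \<and>
      partial_inverse E t r \<and> t \<cdot>\<^bsub>E\<^esub> v' = v \<and> t \<cdot>\<^bsub>E\<^esub> h' = h \<and> r \<cdot>\<^bsub>E\<^esub> v = v' \<and>
      r \<cdot>\<^bsub>E\<^esub> h = h' \<and> Rst E t = Rst E h \<and> Rst E r = Rst E h'"
    using te re by (simp add: partial_inverse_def hom_def)
  then show "((v, h), (v', h')) \<in> srel X Y"
    using s s' unfolding span_rel_def by blast
qed

lemma equiv_span_rel: "equiv (spn X Y) (srel X Y)"
proof (rule equivI)
  show "srel X Y \<subseteq> spn X Y \<times> spn X Y"
    by (auto simp: span_rel_iff)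
  show "refl_on (spn X Y) (srel X Y)"
    by (auto simp: refl_on_def span_rel_iff)
  show "sym (srel X Y)"
    by (auto simp: sym_def span_rel_iff)
  show "trans (srel X Y)"
    by (auto simp: trans_def span_rel_iff)
qed

lemma legs_spans:
  assumes s1: "(v1, h1) \<in> spn X Y" and s2: "(v2, h2) \<in> spn Y Z" and l: "legs h1 v2 w k"
  shows "(w \<cdot>\<^bsub>E\<^esub> v1, k \<cdot>\<^bsub>E\<^esub> h2) \<in> spn X Z"
    and "graph (w \<cdot>\<^bsub>E\<^esub> v1) (k \<cdot>\<^bsub>E\<^esub> h2) = graph v1 h1 O graph v2 h2"
proof -
  note [simp] = spans_arr(1-7)[OF s1] spans_arr(1-7)[OF s2]
  have lp: "latent_pullback E k v2 w h1" and w_sub: "subvertical E B po pa w"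
    and k_prone: "prone E B po pa k"
    using l by (simp_all add: composition_legs_def)
  have [simp]: "k \<in> Arr E" "w \<in> Arr E" "Dom E k = Dom E w" "Cod E k = Dom E h2"
      "Cod E w = Dom E h1" and sq: "k \<cdot>\<^bsub>E\<^esub> v2 = w \<cdot>\<^bsub>E\<^esub> h1"
    and kv: "k \<cdot>\<^bsub>E\<^esub> Rst E v2 = k" and wh: "w \<cdot>\<^bsub>E\<^esub> Rst E h1 = w"
    using lp by (simp_all add: latent_pullback_def)
  have Rkh: "Rst E (k \<cdot>\<^bsub>E\<^esub> h2) = Rst E k" and Rkv: "Rst E (k \<cdot>\<^bsub>E\<^esub> v2) = Rst E k"
    using kv E.Comp_Rst_eq_iff[of k h2] E.Comp_Rst_eq_iff[of k v2] by simp_all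
  have Rwv: "Rst E (w \<cdot>\<^bsub>E\<^esub> v1) = Rst E w" and Rwh: "Rst E (w \<cdot>\<^bsub>E\<^esub> h1) = Rst E w"
    using wh E.Comp_Rst_eq_iff[of w v1] E.Comp_Rst_eq_iff[of w h1] by simp_all
  have Rwk: "Rst E w = Rst E k"
    using Rwh Rkv sq by simp
  have pw: "Rst B (pa w) = pa w" "po (Dom E w) = po (Cod E w)" and pv: "Rst B (pa v1) = pa v1"
    using w_sub s1 by (simp_all add: spans_iff subvertical_iff)
  have "Rst B (pa w \<cdot>\<^bsub>B\<^esub> pa v1) = pa w \<cdot>\<^bsub>B\<^esub> pa v1"
    using B.Rst_Rst_Comp[of "pa w" "pa v1"] pw pv by simp
  moreover have "prone E B po pa (k \<cdot>\<^bsub>E\<^esub> h2)"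
    using k_prone s2 by (intro prone_Comp) (simp_all add: spans_iff)
  ultimately show "(w \<cdot>\<^bsub>E\<^esub> v1, k \<cdot>\<^bsub>E\<^esub> h2) \<in> spn X Z"
    using Rkh Rwv Rwk pw(2) by (simp add: spans_iff subvertical_iff)
  show "graph (w \<cdot>\<^bsub>E\<^esub> v1) (k \<cdot>\<^bsub>E\<^esub> h2) = graph v1 h1 O graph v2 h2"
  proof (intro equalityI subsetI)
    fix x
    assume "x \<in> graph (w \<cdot>\<^bsub>E\<^esub> v1) (k \<cdot>\<^bsub>E\<^esub> h2)"
    then obtain t where t [simp]: "t \<in> Arr E" "Cod E t = Dom E w"
      and tt: "t \<cdot>\<^bsub>E\<^esub> Rst E (w \<cdot>\<^bsub>E\<^esub> v1) = t" and x: "x = (t \<cdot>\<^bsub>E\<^esub> (w \<cdot>\<^bsub>E\<^esub> v1), t \<cdot>\<^bsub>E\<^esub> (k \<cdot>\<^bsub>E\<^esub> h2))"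
      unfolding graph_def by auto
    have "(t \<cdot>\<^bsub>E\<^esub> w) \<cdot>\<^bsub>E\<^esub> Rst E v1 = t \<cdot>\<^bsub>E\<^esub> w" "(t \<cdot>\<^bsub>E\<^esub> k) \<cdot>\<^bsub>E\<^esub> Rst E v2 = t \<cdot>\<^bsub>E\<^esub> k"
      using wh kv by simp_all
    then have "((t \<cdot>\<^bsub>E\<^esub> w) \<cdot>\<^bsub>E\<^esub> v1, (t \<cdot>\<^bsub>E\<^esub> w) \<cdot>\<^bsub>E\<^esub> h1) \<in> graph v1 h1"
      and "((t \<cdot>\<^bsub>E\<^esub> k) \<cdot>\<^bsub>E\<^esub> v2, (t \<cdot>\<^bsub>E\<^esub> k) \<cdot>\<^bsub>E\<^esub> h2) \<in> graph v2 h2"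
      unfolding graph_def by (force simp del: E.assoc)+
    then show "x \<in> graph v1 h1 O graph v2 h2"
      using sq unfolding x by (auto simp: relcomp_unfold)
  next
    fix x
    assume "x \<in> graph v1 h1 O graph v2 h2"
    then obtain s t where st [simp]: "s \<in> Arr E" "Cod E s = Dom E h1" "t \<in> Arr E" "Cod E t = Dom E h2"
      and ss: "s \<cdot>\<^bsub>E\<^esub> Rst E h1 = s" and tt: "t \<cdot>\<^bsub>E\<^esub> Rst E h2 = t"
      and eq: "s \<cdot>\<^bsub>E\<^esub> h1 = t \<cdot>\<^bsub>E\<^esub> v2" and x: "x = (s \<cdot>\<^bsub>E\<^esub> v1, t \<cdot>\<^bsub>E\<^esub> h2)"
      unfolding graph_def by auto
    have D [simp]: "Dom E t = Dom E s"
      using eq E.Comp_arr(2)[of s h1] E.Comp_arr(2)[of t v2] by simp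
    \<comment> \<open>The largest idempotent to which the universal property applies: absorption
      makes the restrictions of \<open>s\<close>, of \<open>t\<close> and of the common composite
      equal.\<close>
    let ?e = "Rst E s"
    have Rs: "Rst E (s \<cdot>\<^bsub>E\<^esub> h1) = Rst E s" and Rtv: "Rst E (t \<cdot>\<^bsub>E\<^esub> v2) = Rst E t"
      and Rth: "Rst E (t \<cdot>\<^bsub>E\<^esub> h2) = Rst E t"
      using ss tt E.Comp_Rst_eq_iff[of s h1] E.Comp_Rst_eq_iff[of t v2] E.Comp_Rst_eq_iff[of t h2]
      by simp_all
    have Rst: "Rst E t = Rst E s"
      using Rs Rtv eq by simp
    have tv: "?e \<cdot>\<^bsub>E\<^esub> (t \<cdot>\<^bsub>E\<^esub> v2) = t \<cdot>\<^bsub>E\<^esub> v2"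
      using Rst E.Rst_Comp_Comp[of t v2] by simp
    have "\<exists>j. j \<in> hom E (Dom E s) (Dom E k) \<and> Rst E j = ?e \<and>
        rle E (j \<cdot>\<^bsub>E\<^esub> k) t \<and> rle E (j \<cdot>\<^bsub>E\<^esub> w) s \<and>
        j \<cdot>\<^bsub>E\<^esub> Rst E k = j \<and> j \<cdot>\<^bsub>E\<^esub> Rst E w = j"
    proof -
      have "Dom E s \<in> Obj E" "t \<in> hom E (Dom E s) (Dom E v2)" "s \<in> hom E (Dom E s) (Dom E h1)"
          "?e \<in> restriction_idempotents E (Dom E s)"
        using E.Dom_Obj by (simp_all add: hom_def restriction_idempotents_def)
      moreover have "?e \<cdot>\<^bsub>E\<^esub> s \<cdot>\<^bsub>E\<^esub> h1 = ?e \<cdot>\<^bsub>E\<^esub> t \<cdot>\<^bsub>E\<^esub> v2 \<and>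
          rle E ?e (Rst E (s \<cdot>\<^bsub>E\<^esub> h1)) \<and> rle E ?e (Rst E (t \<cdot>\<^bsub>E\<^esub> v2))"
        using eq tv Rs Rtv Rst by (simp add: rle_def)
      ultimately show ?thesis
        using lp unfolding latent_pullback_def by blast
    qed
    then obtain j where j [simp]: "j \<in> Arr E" "Dom E j = Dom E s" "Cod E j = Dom E w"
      and Rj: "Rst E j = Rst E s" and jt: "Rst E (j \<cdot>\<^bsub>E\<^esub> k) \<cdot>\<^bsub>E\<^esub> t = j \<cdot>\<^bsub>E\<^esub> k"
      and js: "Rst E (j \<cdot>\<^bsub>E\<^esub> w) \<cdot>\<^bsub>E\<^esub> s = j \<cdot>\<^bsub>E\<^esub> w"
      and jk: "j \<cdot>\<^bsub>E\<^esub> Rst E k = j" and jw: "j \<cdot>\<^bsub>E\<^esub> Rst E w = j"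
      unfolding rle_def hom_def by auto
    \<comment> \<open>With all restrictions equal, the inequalities of the universal property become
      equations.\<close>
    have "Rst E (j \<cdot>\<^bsub>E\<^esub> k) = Rst E t" "Rst E (j \<cdot>\<^bsub>E\<^esub> w) = Rst E s"
      using jk jw Rj Rst E.Comp_Rst_eq_iff[of j k] E.Comp_Rst_eq_iff[of j w] by simp_all
    then have e: "j \<cdot>\<^bsub>E\<^esub> k = t" "j \<cdot>\<^bsub>E\<^esub> w = s"
      using jt js E.Rst_Comp_self by simp_all
    have "x = (j \<cdot>\<^bsub>E\<^esub> (w \<cdot>\<^bsub>E\<^esub> v1), j \<cdot>\<^bsub>E\<^esub> (k \<cdot>\<^bsub>E\<^esub> h2))"
      unfolding x e[symmetric] by simp
    moreover have "j \<cdot>\<^bsub>E\<^esub> Rst E (w \<cdot>\<^bsub>E\<^esub> v1) = j"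
      using Rwv jw by simp
    ultimately show "x \<in> graph (w \<cdot>\<^bsub>E\<^esub> v1) (k \<cdot>\<^bsub>E\<^esub> h2)"
      unfolding graph_def by (intro CollectI exI[of _ j]) simp
  qed
qed

text \<open>Arbitrary legs give a span with the same relation as the legs built from a prone lift,
  hence with the same image of the right leg. For the latter \<open>pa k\<close> is known, and
  \<open>pa v2\<close> is absorbed as the restriction of \<open>pa h2\<close>.\<close>

lemma pa_legs:
  assumes s1: "(v1, h1) \<in> spn X Y" and s2: "(v2, h2) \<in> spn Y Z" and l: "legs h1 v2 w k"
  shows "pa (k \<cdot>\<^bsub>E\<^esub> h2) = pa h1 \<cdot>\<^bsub>B\<^esub> pa h2"
proof -
  note [simp] = spans_arr(1-5,7)[OF s1] spans_arr(1-5,7)[OF s2]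
  have "prone E B po pa h1" "subvertical E B po pa v2" "Cod E h1 = Cod E v2"
    using s1 s2 by (auto simp: spans_iff)
  then obtain w' k' where l': "legs h1 v2 w' k'" and k': "pa k' = pa h1 \<cdot>\<^bsub>B\<^esub> pa v2"
    using composition_legs_exist by blast
  have [simp]: "k' \<in> Arr E" "Cod E k' = Dom E h2"
    using l' by (simp_all add: composition_legs_def latent_pullback_def)
  have "pa (k \<cdot>\<^bsub>E\<^esub> h2) = pa (k' \<cdot>\<^bsub>E\<^esub> h2)"
    using legs_spans[OF s1 s2 l] legs_spans[OF s1 s2 l'] by (metis graph_self pa_eq_of_graph_mem(1))
  also have "\<dots> = pa h1 \<cdot>\<^bsub>B\<^esub> (pa v2 \<cdot>\<^bsub>B\<^esub> pa h2)"
    using k' by simp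
  also have "pa v2 \<cdot>\<^bsub>B\<^esub> pa h2 = pa h2"
    using B.Rst_Comp_self[of "pa h2"] spans_arr(8)[OF s2] by simp
  finally show ?thesis .
qed

text \<open>Hyperconnectedness turns absorption of \<open>e\<close> into a condition on images
  alone. This is what lets the restriction laws be checked in the base.\<close>

lemma graph_idempotent:
  assumes e: "e \<in> Arr E" "Cod E e = Dom E e" "Rst E e = e"
  shows "graph e e =
    Id_on {t \<in> Arr E. Cod E t = Dom E e \<and> pa t \<cdot>\<^bsub>B\<^esub> pa e = pa t}"
proof -
  have pe: "Rst B (pa e) = pa e"
    using e pa_Rst' by metis
  have "t \<cdot>\<^bsub>E\<^esub> e = t \<longleftrightarrow> pa t \<cdot>\<^bsub>B\<^esub> pa e = pa t"
    if [simp]: "t \<in> Arr E" "Cod E t = Dom E e" for t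
  proof
    assume "t \<cdot>\<^bsub>E\<^esub> e = t"
    then show "pa t \<cdot>\<^bsub>B\<^esub> pa e = pa t"
      using pa_Comp'[of t e] e(1) by simp
  next
    assume "pa t \<cdot>\<^bsub>B\<^esub> pa e = pa t"
    then have "Rst E (t \<cdot>\<^bsub>E\<^esub> e) = Rst E t"
      using e(1) by (intro Rst_eq_of_pa) simp_all
    then show "t \<cdot>\<^bsub>E\<^esub> e = t"
      using E.Comp_Rst_eq_iff[of t e] e by simp
  qed
  then show ?thesis
    unfolding graph_def e(3) by (auto simp: Id_on_def) metis
qed

lemma idempotent_spans:
  assumes "e \<in> Arr E" "Cod E e = Dom E e" "Rst E e = e"
  shows "(e, e) \<in> spn (Cod E e) (Cod E e)"
  using assms prone_restriction_idempotent[of e] pa_Rst'[of e] by (simp add: spans_iff subvertical_iff)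

section \<open>The category of spans\<close>

lemma cls_iff: "(v, h) \<in> spn X Y \<Longrightarrow> x \<in> cls v h \<longleftrightarrow> ((v, h), x) \<in> srel X Y"
  using spans_arr(4,5) unfolding span_class_def by blast

lemma cls_eq_iff:
  assumes "(v, h) \<in> spn X Y" "(v', h') \<in> spn X Y"
  shows "cls v h = cls v' h' \<longleftrightarrow> graph v h = graph v' h'"
proof -
  have "cls v h = srel X Y `` {(v, h)}" "cls v' h' = srel X Y `` {(v', h')}"
    using assms spans_arr(4,5) unfolding span_class_def by metis+
  then show ?thesis
    using eq_equiv_class_iff[OF equiv_span_rel assms] assms by (simp add: span_rel_iff)
qed

definition rep where "rep c = (SOME x. x \<in> c)"

lemma rep_cls:
  assumes "(v, h) \<in> spn X Y"
  shows "rep (cls v h) \<in> spn X Y" "graph (fst (rep (cls v h))) (snd (rep (cls v h))) = graph v h"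
    "pa (fst (rep (cls v h))) = pa v" "pa (snd (rep (cls v h))) = pa h"
proof -
  have "(v, h) \<in> cls v h"
    using assms by (simp add: cls_iff span_rel_iff)
  then have "rep (cls v h) \<in> cls v h"
    unfolding rep_def by (rule someI)
  moreover obtain v' h' where r: "rep (cls v h) = (v', h')"
    by fastforce
  ultimately have "((v, h), (v', h')) \<in> srel X Y"
    using cls_iff[OF assms] by simp
  then show "rep (cls v h) \<in> spn X Y"
    "graph (fst (rep (cls v h))) (snd (rep (cls v h))) = graph v h"
    "pa (fst (rep (cls v h))) = pa v" "pa (snd (rep (cls v h))) = pa h"
    using pa_eq_of_graph_mem[of v h X Y v' h'] graph_self[of v h X Y] graph_self[of v' h' X Y]
    unfolding r span_rel_iff by auto
qed

text \<open>Each class determines its two ends, so a map is the bare class. The operations go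
  through a chosen representative, and composition also through chosen legs; \<open>cls_Comp\<close>
  and \<open>cls_Rst\<close> remove these choices.\<close>

definition dual where
  "dual =
    \<lparr>Obj = Obj E,
     Arr = {cls v h | v h X Y. (v, h) \<in> spn X Y},
     Dom = (\<lambda>c. Cod E (fst (rep c))),
     Cod = (\<lambda>c. Cod E (snd (rep c))),
     Id = (\<lambda>X. cls (Id E X) (Id E X)),
     Comp = (\<lambda>c d.
       let (w, k) = (SOME (w, k). legs (snd (rep c)) (fst (rep d)) w k)
       in cls (w \<cdot>\<^bsub>E\<^esub> fst (rep c)) (k \<cdot>\<^bsub>E\<^esub> snd (rep d))),
     Rst = (\<lambda>c. cls (hat E pa (fst (rep c))) (hat E pa (fst (rep c))))\<rparr>"

definition pdual where "pdual c = pa (snd (rep c))"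

definition cgraph where "cgraph c = graph (fst (rep c)) (snd (rep c))"

lemma hom_dual: "hom dual X Y = {cls v h | v h. (v, h) \<in> spn X Y}"
proof -
  have "Dom dual (cls v h) = X" "Cod dual (cls v h) = Y" if "(v, h) \<in> spn X Y" for v h X Y
    using rep_cls(1)[OF that] spans_arr(4,5)[of "fst (rep (cls v h))" "snd (rep (cls v h))" X Y]
    by (simp_all add: dual_def)
  then show ?thesis
    unfolding hom_def by (auto simp: dual_def) blast+
qed

lemma hom_dual_quotient: "hom dual X Y = spn X Y // srel X Y"
proof -
  have "cls v h = srel X Y `` {(v, h)}" if "(v, h) \<in> spn X Y" for v h
    using that spans_arr(4,5) unfolding span_class_def by metis
  then show ?thesis
    unfolding hom_dual quotient_def by fastforce
qed

lemma hom_dual_rep: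
  assumes "c \<in> hom dual X Y"
  shows "rep c \<in> spn X Y"
  using assms rep_cls(1) unfolding hom_dual by auto

lemma cls_dual:
  assumes "(v, h) \<in> spn X Y"
  shows "cls v h \<in> hom dual X Y" "cgraph (cls v h) = graph v h" "pdual (cls v h) = pa h"
  using assms rep_cls[OF assms] unfolding hom_dual cgraph_def pdual_def by auto

lemma dual_eqI:
  assumes "c \<in> hom dual X Y" "d \<in> hom dual X Y" "cgraph c = cgraph d"
  shows "c = d"
proof -
  obtain v h v' h' where s: "(v, h) \<in> spn X Y" "(v', h') \<in> spn X Y"
    and cd: "c = cls v h" "d = cls v' h'"
    using assms(1,2) unfolding hom_dual by auto
  show ?thesis
    using assms(3) unfolding cd cls_dual(2)[OF s(1)] cls_dual(2)[OF s(2)] cls_eq_iff[OF s] .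
qed

lemma cgraph_arr:
  assumes "c \<in> hom dual X Y" and "(m, g) \<in> cgraph c"
  shows "m \<in> Arr E" "g \<in> Arr E" "Dom E m = Dom E g" "Cod E m = X" "Cod E g = Y"
    "pa m \<cdot>\<^bsub>B\<^esub> pdual c = pa g" "Rst B (pa m) = Rst B (pa g)"
proof -
  have "(fst (rep c), snd (rep c)) \<in> spn X Y"
    using hom_dual_rep[OF assms(1)] by simp
  note * = graph_arr[OF this assms(2)[unfolded cgraph_def]]
  show "m \<in> Arr E" "g \<in> Arr E" "Dom E m = Dom E g" "Cod E m = X" "Cod E g = Y"
    "pa m \<cdot>\<^bsub>B\<^esub> pdual c = pa g" "Rst B (pa m) = Rst B (pa g)"
    unfolding pdual_def by (fact *)+
qed

lemma pdual_arr:
  assumes "c \<in> hom dual X Y"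
  shows "pdual c \<in> Arr B" "Dom B (pdual c) = po X" "Cod B (pdual c) = po Y"
  using spans_arr(2,5,7)[of "fst (rep c)" "snd (rep c)" X Y] hom_dual_rep[OF assms]
  by (simp_all add: pdual_def)

lemma hom_dual_Obj:
  assumes "c \<in> hom dual X Y"
  shows "X \<in> Obj E" "Y \<in> Obj E"
  using spans_arr[of "fst (rep c)" "snd (rep c)" X Y] hom_dual_rep[OF assms] E.Cod_Obj by auto

text \<open>The two sides may use different representatives and different latent pullbacks, but both
  spans have the same relational composite as their relation.\<close>

lemma cls_Comp:
  assumes s1: "(v1, h1) \<in> spn X Y" and s2: "(v2, h2) \<in> spn Y Z" and l: "legs h1 v2 w k"
  shows "cls v1 h1 \<cdot>\<^bsub>dual\<^esub> cls v2 h2 = cls (w \<cdot>\<^bsub>E\<^esub> v1) (k \<cdot>\<^bsub>E\<^esub> h2)"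
proof -
  obtain v1' h1' v2' h2' where r: "rep (cls v1 h1) = (v1', h1')" "rep (cls v2 h2) = (v2', h2')"
    by fastforce
  have s1': "(v1', h1') \<in> spn X Y" and s2': "(v2', h2') \<in> spn Y Z"
    and g: "graph v1' h1' = graph v1 h1" "graph v2' h2' = graph v2 h2"
    using rep_cls[OF s1] rep_cls[OF s2] r by simp_all
  have "\<exists>w k. legs h1' v2' w k"
    using composition_legs_exist[of h1' v2'] s1' s2' by (auto simp: spans_iff)
  then have "\<exists>wk. case wk of (w, k) \<Rightarrow> legs h1' v2' w k"
    by auto
  then have "case (SOME (w, k). legs h1' v2' w k) of (w, k) \<Rightarrow> legs h1' v2' w k"
    by (rule someI_ex)
  then obtain w' k' where wk: "(SOME (w, k). legs h1' v2' w k) = (w', k')" "legs h1' v2' w' k'"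
    by (auto split: prod.splits)
  have "cls v1 h1 \<cdot>\<^bsub>dual\<^esub> cls v2 h2 = cls (w' \<cdot>\<^bsub>E\<^esub> v1') (k' \<cdot>\<^bsub>E\<^esub> h2')"
    by (simp add: dual_def r wk(1))
  also have "\<dots> = cls (w \<cdot>\<^bsub>E\<^esub> v1) (k \<cdot>\<^bsub>E\<^esub> h2)"
    using cls_eq_iff[OF legs_spans(1)[OF s1' s2' wk(2)] legs_spans(1)[OF s1 s2 l]]
      legs_spans(2)[OF s1' s2' wk(2)] legs_spans(2)[OF s1 s2 l] g by simp
  finally show ?thesis .
qed

lemma dual_Comp:
  assumes c: "c \<in> hom dual X Y" and d: "d \<in> hom dual Y Z"
  shows "c \<cdot>\<^bsub>dual\<^esub> d \<in> hom dual X Z" "cgraph (c \<cdot>\<^bsub>dual\<^esub> d) = cgraph c O cgraph d"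
    "pdual (c \<cdot>\<^bsub>dual\<^esub> d) = pdual c \<cdot>\<^bsub>B\<^esub> pdual d"
proof -
  obtain v1 h1 v2 h2 where s: "(v1, h1) \<in> spn X Y" "(v2, h2) \<in> spn Y Z"
    and cd: "c = cls v1 h1" "d = cls v2 h2"
    using c d unfolding hom_dual by auto
  obtain w k where l: "legs h1 v2 w k"
    using composition_legs_exist[of h1 v2] s by (auto simp: spans_iff)
  show "c \<cdot>\<^bsub>dual\<^esub> d \<in> hom dual X Z" "cgraph (c \<cdot>\<^bsub>dual\<^esub> d) = cgraph c O cgraph d"
    "pdual (c \<cdot>\<^bsub>dual\<^esub> d) = pdual c \<cdot>\<^bsub>B\<^esub> pdual d"
    using cls_dual[OF legs_spans(1)[OF s l]] legs_spans(2)[OF s l] pa_legs[OF s l]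
      cls_dual(2,3)[OF s(1)] cls_dual(2,3)[OF s(2)] unfolding cd cls_Comp[OF s l] by simp_all
qed

text \<open>The idempotent case with \<open>e\<close> an identity: every \<open>t\<close> into
  \<open>X\<close> absorbs it, even if its image is not an identity of the base.\<close>

lemma dual_Id:
  assumes "X \<in> Obj E"
  shows "Id dual X \<in> hom dual X X" "cgraph (Id dual X) = Id_on {t \<in> Arr E. Cod E t = X}"
    "pdual (Id dual X) = pa (Id E X)"
proof -
  have s: "(Id E X, Id E X) \<in> spn X X"
    using idempotent_spans[of "Id E X"] assms by simp
  have I: "Id dual X = cls (Id E X) (Id E X)"
    by (simp add: dual_def)
  have "pa t \<cdot>\<^bsub>B\<^esub> pa (Id E X) = pa t" if "t \<in> Arr E" "Cod E t = X" for t
    using pa_Comp'[of t "Id E X"] that assms by simp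
  then have "graph (Id E X) (Id E X) = Id_on {t \<in> Arr E. Cod E t = X}"
    using graph_idempotent[of "Id E X"] assms by (auto simp: Id_on_def)
  then show "Id dual X \<in> hom dual X X" "cgraph (Id dual X) = Id_on {t \<in> Arr E. Cod E t = X}"
    "pdual (Id dual X) = pa (Id E X)"
    using cls_dual[OF s] unfolding I by simp_all
qed

lemma hat_spans:
  assumes "(v, h) \<in> spn X Y"
  shows "(hat E pa v, hat E pa v) \<in> spn X X"
    and "graph (hat E pa v) (hat E pa v) =
      Id_on {t \<in> Arr E. Cod E t = X \<and> pa t \<cdot>\<^bsub>B\<^esub> pa v = pa t}"
    and "pa (hat E pa v) = pa v"
proof -
  have v: "subvertical E B po pa v" "Cod E v = X"
    using assms by (simp_all add: spans_iff)
  note * = hat[OF v(1)]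
  show "(hat E pa v, hat E pa v) \<in> spn X X"
    using idempotent_spans[of "hat E pa v"] * v(2) by simp
  show "graph (hat E pa v) (hat E pa v) =
      Id_on {t \<in> Arr E. Cod E t = X \<and> pa t \<cdot>\<^bsub>B\<^esub> pa v = pa t}"
    using graph_idempotent[of "hat E pa v"] * v(2) by simp
  show "pa (hat E pa v) = pa v"
    by (fact *)
qed

text \<open>\<open>hat\<close> sees \<open>v\<close> only through its codomain and its image, and
  equivalent spans agree in both.\<close>

lemma cls_Rst:
  assumes "(v, h) \<in> spn X Y"
  shows "Rst dual (cls v h) = cls (hat E pa v) (hat E pa v)"
proof -
  have "hat E pa (fst (rep (cls v h))) = hat E pa v"
    using rep_cls[OF assms] spans_arr(4)[OF assms]
      spans_arr(4)[of "fst (rep (cls v h))" "snd (rep (cls v h))" X Y]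
    unfolding hat_def by simp
  then show ?thesis
    by (simp add: dual_def)
qed

text \<open>\<open>pa v\<close> is the restriction of \<open>pa h\<close>; phrasing the condition
  through \<open>pdual c\<close> frees it from the representative.\<close>

lemma dual_Rst:
  assumes "c \<in> hom dual X Y"
  shows "Rst dual c \<in> hom dual X X"
    "cgraph (Rst dual c) =
      Id_on {t \<in> Arr E. Cod E t = X \<and> pa t \<cdot>\<^bsub>B\<^esub> Rst B (pdual c) = pa t}"
    "pdual (Rst dual c) = Rst B (pdual c)"
proof -
  obtain v h where s: "(v, h) \<in> spn X Y" and c: "c = cls v h"
    using assms unfolding hom_dual by auto
  show "Rst dual c \<in> hom dual X X"
    "cgraph (Rst dual c) =
      Id_on {t \<in> Arr E. Cod E t = X \<and> pa t \<cdot>\<^bsub>B\<^esub> Rst B (pdual c) = pa t}"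
    "pdual (Rst dual c) = Rst B (pdual c)"
    using cls_dual[OF hat_spans(1)[OF s]] hat_spans(2,3)[OF s] cls_dual(3)[OF s]
      spans_arr(8)[OF s] unfolding c cls_Rst[OF s] by simp_all
qed

section \<open>The axioms of a category, of restriction and of the projection to the base\<close>

lemma category_dual: "category dual"
proof
  fix c
  assume "c \<in> Arr dual"
  then have "c \<in> hom dual (Dom dual c) (Cod dual c)"
    by (simp add: hom_def)
  from hom_dual_Obj[OF this] show "Dom dual c \<in> Obj dual" "Cod dual c \<in> Obj dual"
    by (simp_all add: dual_def)
next
  fix X
  assume "X \<in> Obj dual"
  then show "Id dual X \<in> hom dual X X"
    by (intro dual_Id) (simp add: dual_def)
next
  fix c d X Y Z
  assume c: "c \<in> hom dual X Y" and d: "d \<in> hom dual Y Z"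
  show "c \<cdot>\<^bsub>dual\<^esub> d \<in> hom dual X Z"
    using c d by (rule dual_Comp)
next
  fix c X Y
  assume c: "c \<in> hom dual X Y"
  note I = dual_Id[OF hom_dual_Obj(1)[OF c]] dual_Id[OF hom_dual_Obj(2)[OF c]]
  show "Id dual X \<cdot>\<^bsub>dual\<^esub> c = c"
    by (rule dual_eqI[OF dual_Comp(1)[OF I(1) c] c])
      (use cgraph_arr(1,4)[OF c] in \<open>auto simp: dual_Comp(2)[OF I(1) c] I(2) intro!: Id_on_relcomp\<close>)
  show "c \<cdot>\<^bsub>dual\<^esub> Id dual Y = c"
    by (rule dual_eqI[OF dual_Comp(1)[OF c I(4)] c])
      (use cgraph_arr(2,5)[OF c] in \<open>auto simp: dual_Comp(2)[OF c I(4)] I(5) intro!: relcomp_Id_on\<close>)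
next
  fix c d e W X Y Z
  assume c: "c \<in> hom dual W X" and d: "d \<in> hom dual X Y" and e: "e \<in> hom dual Y Z"
  note cd = dual_Comp[OF c d] and de = dual_Comp[OF d e]
  show "c \<cdot>\<^bsub>dual\<^esub> d \<cdot>\<^bsub>dual\<^esub> e = c \<cdot>\<^bsub>dual\<^esub> (d \<cdot>\<^bsub>dual\<^esub> e)"
    by (rule dual_eqI[OF dual_Comp(1)[OF cd(1) e] dual_Comp(1)[OF c de(1)]])
      (simp add: dual_Comp(2)[OF cd(1) e] dual_Comp(2)[OF c de(1)] cd(2) de(2) O_assoc)
qed

lemma restriction_category_dual: "restriction_category dual"
proof (intro restriction_category.intro category_dual restriction_category_axioms.intro)
  fix c X Y
  assume c: "c \<in> hom dual X Y"
  note Rc = dual_Rst[OF c]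
  show "Rst dual c \<in> hom dual X X"
    by (fact Rc)
  note [simp] = pdual_arr[OF c]
  \<comment> \<open>R.1: \<open>pa m\<close> followed by \<open>pdual c\<close> is
    \<open>pa g\<close>, which has the restriction of \<open>pa m\<close>, so \<open>pa m\<close>
    absorbs the restriction of \<open>pdual c\<close>.\<close>
  have tot: "pa m \<cdot>\<^bsub>B\<^esub> Rst B (pdual c) = pa m" if "(m, g) \<in> cgraph c" for m g
    using cgraph_arr[OF c that] B.Comp_Rst_eq_iff[of "pa m" "pdual c"] by simp
  show "Rst dual c \<cdot>\<^bsub>dual\<^esub> c = c"
  proof (rule dual_eqI[OF dual_Comp(1)[OF Rc(1) c] c])
    show "cgraph (Rst dual c \<cdot>\<^bsub>dual\<^esub> c) = cgraph c"
      unfolding dual_Comp(2)[OF Rc(1) c] Rc(2) using cgraph_arr(1,4)[OF c] tot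
      by (intro Id_on_relcomp CollectI conjI) blast+
  qed
next
  fix c d X Y Z
  assume c: "c \<in> hom dual X Y" and d: "d \<in> hom dual X Z"
  note Rc = dual_Rst[OF c] and Rd = dual_Rst[OF d]
  note RcRd = dual_Comp[OF Rc(1) Rd(1)] and RdRc = dual_Comp[OF Rd(1) Rc(1)]
    and Rcd = dual_Comp[OF Rc(1) d]
  note [simp] = pdual_arr[OF c] pdual_arr[OF d]
  show "Rst dual c \<cdot>\<^bsub>dual\<^esub> Rst dual d = Rst dual d \<cdot>\<^bsub>dual\<^esub> Rst dual c"
    by (rule dual_eqI[OF RcRd(1) RdRc(1)]) (auto simp: RcRd(2) RdRc(2) Rc(2) Rd(2))
  let ?r = "Rst B (pdual c)" and ?s = "Rst B (pdual d)"
  have R: "Rst B (pdual (Rst dual c \<cdot>\<^bsub>dual\<^esub> d)) = ?r \<cdot>\<^bsub>B\<^esub> ?s"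
    by (simp add: Rcd(3) Rc(3) B.Rst_Rst_Comp)
  \<comment> \<open>R.3 comes down to this: absorbing a product of commuting idempotents amounts to
    absorbing each factor, which matches the intersection of two identity relations.\<close>
  have "u \<cdot>\<^bsub>B\<^esub> (?r \<cdot>\<^bsub>B\<^esub> ?s) = u \<longleftrightarrow> u \<cdot>\<^bsub>B\<^esub> ?r = u \<and> u \<cdot>\<^bsub>B\<^esub> ?s = u"
    if u: "u \<in> Arr B" "Cod B u = po X" for u
  proof
    assume *: "u \<cdot>\<^bsub>B\<^esub> (?r \<cdot>\<^bsub>B\<^esub> ?s) = u"
    have "u \<cdot>\<^bsub>B\<^esub> ?s = u \<cdot>\<^bsub>B\<^esub> (?r \<cdot>\<^bsub>B\<^esub> (?s \<cdot>\<^bsub>B\<^esub> ?s))"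
      using * u B.assoc[of u "?r \<cdot>\<^bsub>B\<^esub> ?s" ?s] by simp
    moreover have "u \<cdot>\<^bsub>B\<^esub> ?r = u \<cdot>\<^bsub>B\<^esub> (?s \<cdot>\<^bsub>B\<^esub> (?r \<cdot>\<^bsub>B\<^esub> ?r))"
      using * u B.assoc[of u "?s \<cdot>\<^bsub>B\<^esub> ?r" ?r] B.Rst_commute[of "pdual c" "pdual d"] by simp
    ultimately show "u \<cdot>\<^bsub>B\<^esub> ?r = u \<and> u \<cdot>\<^bsub>B\<^esub> ?s = u"
      using * B.Rst_commute[of "pdual c" "pdual d"] by simp
  next
    assume *: "u \<cdot>\<^bsub>B\<^esub> ?r = u \<and> u \<cdot>\<^bsub>B\<^esub> ?s = u"
    then show "u \<cdot>\<^bsub>B\<^esub> (?r \<cdot>\<^bsub>B\<^esub> ?s) = u"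
      using u B.assoc[of u ?r ?s] by simp
  qed
  then have iff: "pa t \<cdot>\<^bsub>B\<^esub> (?r \<cdot>\<^bsub>B\<^esub> ?s) = pa t \<longleftrightarrow> pa t \<cdot>\<^bsub>B\<^esub> ?r = pa t \<and> pa t \<cdot>\<^bsub>B\<^esub> ?s = pa t"
    if "t \<in> Arr E" "Cod E t = X" for t
    using that by simp
  show "Rst dual (Rst dual c \<cdot>\<^bsub>dual\<^esub> d) = Rst dual c \<cdot>\<^bsub>dual\<^esub> Rst dual d"
    by (rule dual_eqI[OF dual_Rst(1)[OF Rcd(1)] RcRd(1)])
      (auto simp: dual_Rst(2)[OF Rcd(1)] RcRd(2) Rc(2) Rd(2) R iff relcomp_unfold Id_on_def)
next
  fix c d X Y Z
  assume c: "c \<in> hom dual X Y" and d: "d \<in> hom dual Y Z"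
  note Rd = dual_Rst[OF d] and cd = dual_Comp[OF c d]
  note Rcd = dual_Rst[OF cd(1)]
  note cRd = dual_Comp[OF c Rd(1)] and Rcdc = dual_Comp[OF Rcd(1) c]
  note [simp] = pdual_arr[OF c] pdual_arr[OF d]
  \<comment> \<open>R.4: along a pair of the relation, \<open>pa g\<close> is \<open>pa m\<close>
    followed by \<open>pdual c\<close> with the same restriction, so the condition on
    \<open>g\<close> for \<open>d\<close> is the condition on \<open>m\<close> for the
    composite.\<close>
  have iff: "pa g \<cdot>\<^bsub>B\<^esub> Rst B (pdual d) = pa g \<longleftrightarrow>
      pa m \<cdot>\<^bsub>B\<^esub> Rst B (pdual c \<cdot>\<^bsub>B\<^esub> pdual d) = pa m" if "(m, g) \<in> cgraph c" for m g
  proof -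
    note mg = cgraph_arr[OF c that]
    have "Rst B (pa g \<cdot>\<^bsub>B\<^esub> pdual d) = Rst B (pa m \<cdot>\<^bsub>B\<^esub> (pdual c \<cdot>\<^bsub>B\<^esub> pdual d))"
      using mg B.assoc[of "pa m" "pdual c" "pdual d"] by simp
    then show ?thesis
      using mg B.Comp_Rst_eq_iff[of "pa g" "pdual d"]
        B.Comp_Rst_eq_iff[of "pa m" "pdual c \<cdot>\<^bsub>B\<^esub> pdual d"] by simp
  qed
  show "c \<cdot>\<^bsub>dual\<^esub> Rst dual d = Rst dual (c \<cdot>\<^bsub>dual\<^esub> d) \<cdot>\<^bsub>dual\<^esub> c"
  proof (rule dual_eqI[OF cRd(1) Rcdc(1)])
    show "cgraph (c \<cdot>\<^bsub>dual\<^esub> Rst dual d) = cgraph (Rst dual (c \<cdot>\<^bsub>dual\<^esub> d) \<cdot>\<^bsub>dual\<^esub> c)"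
      unfolding cRd(2) Rcdc(2) Rd(2) Rcd(2) cd(3)
      by (rule relcomp_Id_on_commute) (use iff cgraph_arr(1,2,4,5)[OF c] in blast)
  qed
qed

lemma restriction_semifunctor_dual: "restriction_semifunctor dual B po pdual"
proof (intro restriction_semifunctor.intro restriction_category_dual B.restriction_category_axioms
    restriction_semifunctor_axioms.intro)
  fix X
  assume "X \<in> Obj dual"
  then show "po X \<in> Obj B"
    using po_Obj by (simp add: dual_def)
next
  fix c X Y
  assume c: "c \<in> hom dual X Y"
  show "pdual c \<in> hom B (po X) (po Y)"
    using pdual_arr[OF c] by (simp add: hom_def)
  show "pdual (Rst dual c) = Rst B (pdual c)"
    using c by (rule dual_Rst)
qed (rule dual_Comp)

end

text \<open>The projection sends the identity at \<open>X\<close> to \<open>pa (Id E X)\<close>, so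
  it is a semifunctor in general and preserves identities when \<open>p\<close> does. Quantifying
  over all composition legs and all representatives puts well-definedness of the composition into
  the statement.\<close>

theorem proposition6p2:
  fixes E :: "('o, 'm) rcat" and B :: "('b, 'n) rcat"
    and po :: "'o \<Rightarrow> 'b" and pa :: "'m \<Rightarrow> 'n"
  assumes "latent_hyperfibration E B po pa"
  shows
    "(\<forall>X \<in> Obj E. \<forall>Y \<in> Obj E. equiv (spans E B po pa X Y) (span_rel E B po pa X Y)) \<and>
     (\<exists>Es :: ('o, ('m \<times> 'm) set) rcat.
        restriction_category Es \<and>
        Obj Es = Obj E \<and>
        (\<forall>X \<in> Obj E. \<forall>Y \<in> Obj E. hom Es X Y = spans E B po pa X Y // span_rel E B po pa X Y) \<and>
        (\<forall>X \<in> Obj E. \<forall>Y \<in> Obj E. \<forall>Z \<in> Obj E.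
           \<forall>(v1, h1) \<in> spans E B po pa X Y. \<forall>(v2, h2) \<in> spans E B po pa Y Z.
             (\<exists>w k. composition_legs E B po pa h1 v2 w k) \<and>
             (\<forall>w k. composition_legs E B po pa h1 v2 w k \<longrightarrow>
                span_class E B po pa v1 h1 \<cdot>\<^bsub>Es\<^esub> span_class E B po pa v2 h2 =
                span_class E B po pa (w \<cdot>\<^bsub>E\<^esub> v1) (k \<cdot>\<^bsub>E\<^esub> h2))) \<and>
        (\<forall>X \<in> Obj E. Id Es X = span_class E B po pa (Id E X) (Id E X)) \<and>
        (\<forall>X \<in> Obj E. \<forall>Y \<in> Obj E. \<forall>(v, h) \<in> spans E B po pa X Y.
           Rst Es (span_class E B po pa v h) = span_class E B po pa (hat E pa v) (hat E pa v)) \<and>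
        (\<exists>ps :: ('m \<times> 'm) set \<Rightarrow> 'n.
           restriction_semifunctor Es B po ps \<and>
           (restriction_functor E B po pa \<longrightarrow> restriction_functor Es B po ps) \<and>
           (\<forall>X \<in> Obj E. \<forall>Y \<in> Obj E. \<forall>(v, h) \<in> spans E B po pa X Y.
              ps (span_class E B po pa v h) = pa h)))"
proof -
  interpret latent_hyperfibration E B po pa
    by (fact assms)
  have Comp: "(\<exists>w k. legs h1 v2 w k) \<and> (\<forall>w k. legs h1 v2 w k \<longrightarrow>
      cls v1 h1 \<cdot>\<^bsub>dual\<^esub> cls v2 h2 = cls (w \<cdot>\<^bsub>E\<^esub> v1) (k \<cdot>\<^bsub>E\<^esub> h2))"
    if "(v1, h1) \<in> spn X Y" "(v2, h2) \<in> spn Y Z" for X Y Z v1 h1 v2 h2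
    using cls_Comp[OF that] composition_legs_exist[of h1 v2] that by (auto simp: spans_iff)
  have func: "restriction_functor dual B po pdual" if "restriction_functor E B po pa"
  proof (intro restriction_functor.intro restriction_semifunctor_dual
      restriction_functor_axioms.intro)
    fix X
    assume "X \<in> Obj dual"
    then have X: "X \<in> Obj E"
      by (simp add: dual_def)
    show "pdual (Id dual X) = Id B (po X)"
      using dual_Id(3)[OF X] restriction_functor.pa_Id[OF that X] by simp
  qed
  show ?thesis
  proof (intro conjI exI[of _ dual] exI[of _ pdual] ballI impI)
    show "equiv (spn X Y) (srel X Y)" for X Y
      by (rule equiv_span_rel)
    show "restriction_category dual"
      by (rule restriction_category_dual)
    show "Obj dual = Obj E"
      by (simp add: dual_def)
    show "hom dual X Y = spn X Y // srel X Y" for X Y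
      by (rule hom_dual_quotient)
    show "Id dual X = cls (Id E X) (Id E X)" for X
      by (simp add: dual_def)
    show "restriction_semifunctor dual B po pdual"
      by (rule restriction_semifunctor_dual)
    show "restriction_functor dual B po pdual" if "restriction_functor E B po pa"
      using that by (rule func)
  next
    fix X Y Z s
    assume "s \<in> spn X Y"
    then show "case s of (v1, h1) \<Rightarrow> \<forall>(v2, h2) \<in> spn Y Z.
        (\<exists>w k. legs h1 v2 w k) \<and> (\<forall>w k. legs h1 v2 w k \<longrightarrow>
          cls v1 h1 \<cdot>\<^bsub>dual\<^esub> cls v2 h2 = cls (w \<cdot>\<^bsub>E\<^esub> v1) (k \<cdot>\<^bsub>E\<^esub> h2))"
      using Comp by (cases s) blast
  next
    fix X Y s
    assume "s \<in> spn X Y"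
    then show "case s of (v, h) \<Rightarrow> Rst dual (cls v h) = cls (hat E pa v) (hat E pa v)"
      using cls_Rst by (cases s) auto
  next
    fix X Y s
    assume "s \<in> spn X Y"
    then show "case s of (v, h) \<Rightarrow> pdual (cls v h) = pa h"
      using cls_dual(3) by (cases s) auto
  qed
qed

end
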